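(* Let $\mathcal{SV}$ be the Schrödinger-Virasoro conformal algebra, and for $a\in\mathbb{C}$ let $\mathbb{C}_a$ be its one-dimensional module on which $\partial$ acts as the scalar $a$ and $\mathcal{SV}$ acts trivially. If $a\neq 0$, then the reduced cohomology satisfies $H^q(\mathcal{SV},\mathbb{C}_a)=0$ for every $q\in\mathbb{Z}_+$.
   Context: All vector spaces and tensor products are over $\mathbb{C}$; $\mathbb{Z}_+$ is the set of nonnegative integers. A Lie conformal algebra $\mathcal{A}$ is a $\mathbb{C}[\partial]$-module with a $\mathbb{C}$-bilinear map $\mathcal{A}\otimes\mathcal{A}\to\mathbb{C}[\lambda]\otimes\mathcal{A}$, $a\otimes b\mapsto[a_\lambda b]$, such that for all $a,b,c\in\mathcal{A}$: $[(\partial a)_\lambda b]=-\lambda[a_\lambda b]$, $[a_\lambda(\partial b)]=(\partial+\lambda)[a_\lambda b]$, $[a_\lambda b]=-[b_{-\lambda-\partial}a]$, and $[a_\lambda[b_\mu c]]=[[a_\lambda b]_{\lambda+\mu}c]+[b_\mu[a_\lambda c]]$. The Schrödinger-Virasoro conformal algebra is $\mathcal{SV}=\mathbb{C}[\partial]L\oplus\mathbb{C}[\partial]M\oplus\mathbb{C}[\partial]Y$ (free $\mathbb{C}[\partial]$-module of rank 3) with nontrivial $\lambda$-brackets of generators $$[L_\lambda L]=(\partial+2\lambda)L,\quad [L_\lambda Y]=(\partial+\tfrac32\lambda)Y,\quad [Y_\lambda L]=(\tfrac12\partial+\tfrac32\lambda)Y,$$ $$[Y_\lambda Y]=(\partial+2\lambda)M,\quad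 [L_\lambda M]=(\partial+\lambda)M,\quad [M_\lambda L]=\lambda M,$$ all other $\lambda$-brackets of generators being zero. The module $\mathbb{C}_a$: $\mathbb{C}_a=\mathbb{C}$ as a vector space, with $\partial v=av$ and $b_\lambda v=0$ for all $b\in\mathcal{SV}$, $v\in\mathbb{C}_a$. Basic complex with coefficients in $V=\mathbb{C}_a$. For $n\in\mathbb{Z}_+$, $\tilde C^n(\mathcal{A},V)$ is the space of $n$-cochains: $\mathbb{C}$-linear maps $\gamma:\mathcal{A}^{\otimes n}\to V[\lambda_1,\ldots,\lambda_n]$, $a_1\otimes\cdots\otimes a_n\mapsto\gamma_{\lambda_1,\ldots,\lambda_n}(a_1,\ldots,a_n)$, such that (1) $\gamma_{\lambda_1,\ldots,\lambda_n}(a_1,\ldots,\partial a_i,\ldots,a_n)=-\lambda_i\gamma_{\lambda_1,\ldots,\lambda_n}(a_1,\ldots,a_n)$ for each $i$; (2) $\gamma$ is skew-symmetric under simultaneous permutations of the $a_i$'s and $\lambda_i$'s. In particular $\tilde C^0(\mathcal{A},V)=V$. Since $\mathcal{SV}$ acts trivially on $\mathbb{C}_a$, the differential $d=d_n:\tilde C^n\to\tilde C^{n+1}$ is $$(d\gamma)_{\lambda_1,\ldots,\lambda_{n+1}}(a_1,\ldots,a_{n+1})=\sum_{1\le i<j\le n+1}(-1)^{i+j}\gamma_{\lambda_i+\lambda_j,\lambda_1,\ldots,\widehat{\lambda_i},\ldots,\widehat{\lambda_j},\ldots,\lambda_{n+1}}([{a_i}_{\lambda_i}a_j],a_1,\ldots,\widehat{a_i},\ldots,\widehat{a_j},\ldots,a_{n+1}),$$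 where $\gamma$ is extended linearly over polynomials in the $\lambda_i$ (hats denote omission; $d_0=0$); $d^2=0$. Reduced cohomology. Let $\partial$ act on $\tilde C^n(\mathcal{A},V)$ by $(\partial\gamma)_{\lambda_1,\ldots,\lambda_n}(a_1,\ldots,a_n)=\big(\partial_V+\sum_{i=1}^n\lambda_i\big)\gamma_{\lambda_1,\ldots,\lambda_n}(a_1,\ldots,a_n)$, where $\partial_V$ is the action of $\partial$ on $V$ (here $\partial_V=a$). Then $d\partial=\partial d$, so $\partial\tilde C^\bullet$ is a subcomplex of $\tilde C^\bullet$. The reduced complex is the quotient complex $\tilde C^\bullet/\partial\tilde C^\bullet$ with the induced differential, and $H^q(\mathcal{A},V)$ is its $q$-th cohomology. *)

theory Defs
  imports
    "HOL-Analysis.Finite_Cartesian_Product"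
    "HOL-Computational_Algebra.Polynomial"
    "HOL-Library.Poly_Mapping"
    "HOL-Combinatorics.Permutations"
    "HOL-Algebra.Elementary_Groups"
begin

section \<open>The Schroedinger-Virasoro conformal algebra\<close>

datatype gen = GenL | GenM | GenY

instance gen :: finite
proof
  have "(UNIV :: gen set) = {GenL, GenM, GenY}"
    by (auto intro: gen.exhaust)
  then show "finite (UNIV :: gen set)"
    by (metis finite.emptyI finite_insert)
qed

text \<open>
  The free module of rank 3 over the polynomials in \<open>\<partial>\<close>. Polynomials act by \<open>*s\<close>, so
  \<open>\<partial> x\<close> is \<open>[:0, 1:] *s x\<close> and a complex number \<open>c\<close> acts as \<open>[:c:] *s x\<close>.
\<close>

type_synonym sv = "complex poly ^ gen"

definition sv_del :: "sv \<Rightarrow> sv" where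
  "sv_del x = [:0, 1:] *s x"

definition sv_scale :: "complex \<Rightarrow> sv \<Rightarrow> sv" where
  "sv_scale c x = [:c:] *s x"

text \<open>
  \<open>SV[\<lambda>]\<close> is the free module of rank 3 over the polynomials in \<open>\<lambda>\<close> (outer variable)
  with coefficients polynomials in \<open>\<partial>\<close> (inner variable).
\<close>

type_synonym sv_lam = "complex poly poly ^ gen"

definition lam :: "complex poly poly" where
  "lam = [:0, 1:]"

definition del :: "complex poly poly" where
  "del = [:[:0, 1:]:]"

definition cst :: "complex \<Rightarrow> complex poly poly" where
  "cst c = [:[:c:]:]"

fun gen_bracket :: "gen \<Rightarrow> gen \<Rightarrow> sv_lam" where
  "gen_bracket GenL GenL = (del + 2 * lam) *s axis GenL 1"
| "gen_bracket GenL GenY = (del + cst (3/2) * lam) *s axis GenY 1"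
| "gen_bracket GenY GenL = (cst (1/2) * del + cst (3/2) * lam) *s axis GenY 1"
| "gen_bracket GenY GenY = (del + 2 * lam) *s axis GenM 1"
| "gen_bracket GenL GenM = (del + lam) *s axis GenM 1"
| "gen_bracket GenM GenL = lam *s axis GenM 1"
| "gen_bracket _ _ = 0"

text \<open>\<open>poly_at f p\<close> is the value \<open>f(p)\<close> of \<open>f\<close> at an element \<open>p\<close> of the algebra of polynomials in \<open>\<lambda>, \<partial>\<close>.\<close>

definition poly_at :: "complex poly \<Rightarrow> complex poly poly \<Rightarrow> complex poly poly" where
  "poly_at f p = poly (map_poly cst f) p"

text \<open>
  The extension of the brackets of generators forced by sesquilinearity:
  \<open>[f(\<partial>)X \<^sub>\<lambda> g(\<partial>)Z] = f(-\<lambda>) g(\<partial> + \<lambda>) [X \<^sub>\<lambda> Z]\<close>.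
\<close>

definition sv_bracket :: "sv \<Rightarrow> sv \<Rightarrow> sv_lam" where
  "sv_bracket x y =
     (\<Sum>X\<in>UNIV. \<Sum>Z\<in>UNIV. (poly_at (x $ X) (- lam) * poly_at (y $ Z) (del + lam)) *s gen_bracket X Z)"

text \<open>The coefficient in \<open>SV\<close> of \<open>\<lambda>\<close> to the power \<open>k\<close>.\<close>

definition lam_coeff :: "sv_lam \<Rightarrow> nat \<Rightarrow> sv" where
  "lam_coeff B k = (\<chi> W. coeff (B $ W) k)"

lemma cst_simps [simp]:
  "cst 0 = 0" "cst 1 = 1" "cst (a + b) = cst a + cst b" "cst (a * b) = cst a * cst b"
  by (simp_all add: cst_def one_pCons)

lemma poly_at_simps [simp]:
  "poly_at 0 p = 0"
  "poly_at (pCons c f) p = cst c + p * poly_at f p"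
  "poly_at 1 p = 1"
  by (simp_all add: poly_at_def map_poly_pCons map_poly_1)

lemma sv_bracket_gen: "sv_bracket (axis X 1) (axis Z 1) = gen_bracket X Z"
proof -
  have 1: "poly_at (axis U (1::complex poly) $ V) p = (if V = U then 1 else 0)"
    for U V :: gen and p
    by (simp add: axis_def)
  show ?thesis
    unfolding sv_bracket_def 1
    by (simp add: vec_eq_iff sum_component if_distrib[of "\<lambda>t. t * _"] if_distrib[of "\<lambda>t. _ * t"]
        sum.delta cong: if_cong)
qed

lemma sv_bracket_sesquilinear:
  "sv_bracket (sv_del x) y = (- lam) *s sv_bracket x y"
  "sv_bracket x (sv_del y) = (del + lam) *s sv_bracket x y"
  by (simp_all add: vec_eq_iff sv_bracket_def sv_del_def sum_component sum_distrib_left mult_ac)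


section \<open>Polynomials in the variables \<open>\<lambda>\<close>\<close>

text \<open>
  Finitely supported coefficient functions on monomials, with the ring structure of
  \<open>HOL-Library.Poly_Mapping\<close>. The variables are \<open>Var 0, Var 1, \<dots>\<close>; the \<open>\<lambda>\<close> with index \<open>i\<close> in the
  usual 1-based notation is \<open>Var (i - 1)\<close>.
\<close>

type_synonym lpoly = "(nat \<Rightarrow>\<^sub>0 nat) \<Rightarrow>\<^sub>0 complex"

definition Const :: "complex \<Rightarrow> lpoly" where
  "Const c = Poly_Mapping.single 0 c"

definition Var :: "nat \<Rightarrow> lpoly" where
  "Var i = Poly_Mapping.single (Poly_Mapping.single i 1) 1"

definition lvars :: "lpoly \<Rightarrow> nat set" where
  "lvars p = (\<Union>m\<in>Poly_Mapping.keys p. Poly_Mapping.keys m)"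

text \<open>Substitution of \<open>s i\<close> for \<open>Var i\<close>.\<close>

definition lsubst :: "(nat \<Rightarrow> lpoly) \<Rightarrow> lpoly \<Rightarrow> lpoly" where
  "lsubst s p = (\<Sum>m\<in>Poly_Mapping.keys p. Const (Poly_Mapping.lookup p m) * (\<Prod>i\<in>Poly_Mapping.keys m. s i ^ Poly_Mapping.lookup m i))"


section \<open>The basic complex with coefficients in the module \<open>\<complex>\<^sub>a\<close>\<close>

text \<open>
  A cochain of degree \<open>n\<close> is a multilinear map on \<open>n\<close>-tuples, represented as lists of length \<open>n\<close>;
  it is normalised to be \<open>0\<close> on lists of other lengths, so that equality of cochains is equality
  of functions.
\<close>

type_synonym cochain = "sv list \<Rightarrow> lpoly"

definition is_cochain :: "nat \<Rightarrow> cochain \<Rightarrow> bool" where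
  "is_cochain n g \<longleftrightarrow>
     (\<forall>xs. length xs \<noteq> n \<longrightarrow> g xs = 0) \<and>
     (\<forall>xs. length xs = n \<longrightarrow> lvars (g xs) \<subseteq> {..<n}) \<and>
     (\<forall>xs i x y. length xs = n \<longrightarrow> i < n \<longrightarrow> g (xs[i := x + y]) = g (xs[i := x]) + g (xs[i := y])) \<and>
     (\<forall>xs i c x. length xs = n \<longrightarrow> i < n \<longrightarrow> g (xs[i := sv_scale c x]) = Const c * g (xs[i := x])) \<and>
     (\<forall>xs i x. length xs = n \<longrightarrow> i < n \<longrightarrow> g (xs[i := sv_del x]) = - Var i * g (xs[i := x])) \<and>
     (\<forall>xs p. length xs = n \<longrightarrow> p permutes {..<n} \<longrightarrow>
        lsubst (\<lambda>k. Var (p k)) (g (map (\<lambda>i. xs ! p i) [0..<n])) = of_int (sign p) * g xs)"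

text \<open>Omitting the entries with (0-based) indices \<open>i\<close> and \<open>j\<close>.\<close>

definition omit2 :: "nat \<Rightarrow> nat \<Rightarrow> 'b list \<Rightarrow> 'b list" where
  "omit2 i j xs = nths xs (- {i, j})"

text \<open>
  The value of \<open>g\<close> with first argument \<open>B = \<Sum>\<^sub>k \<lambda>\<^sup>k B\<^sub>k\<close> in \<open>SV[\<lambda>]\<close>, extended linearly over the
  polynomials in \<open>\<lambda>\<close>: here \<open>t\<close> is the polynomial to be used for \<open>\<lambda>\<close>, and the list \<open>us\<close> contains
  the polynomials to be used for the variables of \<open>g\<close>.
\<close>

definition ext_eval :: "cochain \<Rightarrow> lpoly list \<Rightarrow> lpoly \<Rightarrow> sv_lam \<Rightarrow> sv list \<Rightarrow> lpoly" where
  "ext_eval g us t B ys =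
     (\<Sum>k | lam_coeff B k \<noteq> 0. t ^ k * lsubst (\<lambda>m. us ! m) (g (lam_coeff B k # ys)))"

text \<open>
  The signs are unaffected by 0-based indexing, as both indices are shifted by 1. For \<open>n = 0\<close> the
  sum is empty, so the differential in degree 0 vanishes.
\<close>

definition cochain_d :: "nat \<Rightarrow> cochain \<Rightarrow> cochain" where
  "cochain_d n g xs =
     (if length xs = n + 1 then
        \<Sum>j<n+1. \<Sum>i<j. (- 1) ^ (i + j) *
          ext_eval g ((Var i + Var j) # omit2 i j (map Var [0..<n+1])) (Var i)
            (sv_bracket (xs ! i) (xs ! j)) (omit2 i j xs)
      else 0)"

definition cochain_del :: "complex \<Rightarrow> nat \<Rightarrow> cochain \<Rightarrow> cochain" where
  "cochain_del a n g xs = (Const a + (\<Sum>i<n. Var i)) * g xs"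


section \<open>Reduced cohomology\<close>

text \<open>
  Only the additive structure is recorded below. Quotients by subspaces have the same underlying
  additive group as the quotient vector spaces, and a vector space is zero iff its additive group
  is trivial.
\<close>

definition cochain_group :: "nat \<Rightarrow> cochain monoid" where
  "cochain_group n =
     \<lparr>carrier = {g. is_cochain n g}, mult = (\<lambda>g h xs. g xs + h xs), one = (\<lambda>_. 0)\<rparr>"

definition del_cochains :: "complex \<Rightarrow> nat \<Rightarrow> cochain set" where
  "del_cochains a n = cochain_del a n ` carrier (cochain_group n)"

definition reduced_group :: "complex \<Rightarrow> nat \<Rightarrow> cochain set monoid" where
  "reduced_group a n = cochain_group n Mod del_cochains a n"

text \<open>
  The induced differential sends the class of \<open>g\<close> to the class of \<open>cochain_d n g\<close>; the union
  is over equal cosets, since \<open>cochain_d\<close> is additive and commutes with \<open>cochain_del\<close>.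
\<close>

definition reduced_d :: "complex \<Rightarrow> nat \<Rightarrow> cochain set \<Rightarrow> cochain set" where
  "reduced_d a n X =
     (\<Union>g\<in>X. del_cochains a (Suc n) #>\<^bsub>cochain_group (Suc n)\<^esub> cochain_d n g)"

definition reduced_cocycles :: "complex \<Rightarrow> nat \<Rightarrow> cochain set set" where
  "reduced_cocycles a n = kernel (reduced_group a n) (reduced_group a (Suc n)) (reduced_d a n)"

definition reduced_coboundaries :: "complex \<Rightarrow> nat \<Rightarrow> cochain set set" where
  "reduced_coboundaries a n =
     (case n of
        0 \<Rightarrow> {\<one>\<^bsub>reduced_group a 0\<^esub>}
      | Suc m \<Rightarrow> reduced_d a m ` carrier (reduced_group a m))"

definition reduced_cohomology :: "complex \<Rightarrow> nat \<Rightarrow> cochain set set monoid" where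
  "reduced_cohomology a q =
     ((reduced_group a q)\<lparr>carrier := reduced_cocycles a q\<rparr>) Mod reduced_coboundaries a q"

end

theory Submission
  imports Defs
begin

text \<open>
  Contracting a cochain with \<open>L\<close> at \<open>\<lambda> = 0\<close> gives a map \<open>h\<close> lowering the degree by one. As
  \<open>[L \<^sub>\<lambda> b]\<close> equals \<open>\<partial> b\<close> at \<open>\<lambda> = 0\<close> for every \<open>b\<close> and \<open>\<partial>\<close> turns into \<open>- \<lambda>\<^sub>i\<close> in the arguments of a
  cochain, Cartan's formula reads \<open>h d + d h = \<Sum> \<lambda>\<^sub>i\<close>. Modulo \<open>\<partial> = a + \<Sum> \<lambda>\<^sub>i\<close> the right-hand side
  is the scalar \<open>- a\<close>. Hence \<open>d g = \<partial> \<phi>\<close> implies \<open>a g = \<partial> (g - h \<phi>) - d (h g)\<close>, and for \<open>a \<noteq> 0\<close>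
  every reduced cocycle is a coboundary.

  As the quotient consists of the cosets of cocycles only, this inclusion makes it trivial, and
  \<open>d\<^sup>2 = 0\<close> does not enter.
\<close>


section \<open>Substitution in polynomials\<close>

definition mono_at :: "(nat \<Rightarrow> lpoly) \<Rightarrow> (nat \<Rightarrow>\<^sub>0 nat) \<Rightarrow> lpoly" where
  "mono_at s m = (\<Prod>i\<in>Poly_Mapping.keys m. s i ^ Poly_Mapping.lookup m i)"

lemma Const_simps [simp]:
  "Const 0 = 0" "Const 1 = 1" "Const (c + e) = Const c + Const e"
  "Const (c * e) = Const c * Const e" "Const (- c) = - Const c"
  by (simp_all add: Const_def single_add mult_single single_uminus)

text \<open>Indices outside the keys have exponent 0 and contribute the factor 1. Over a common
  finite index set the products for two monomials can be multiplied factor by factor;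
  \<open>lsubst_superset\<close> plays the same part for sums.\<close>

lemma mono_at_superset:
  assumes "finite A" "Poly_Mapping.keys m \<subseteq> A"
  shows "mono_at s m = (\<Prod>i\<in>A. s i ^ Poly_Mapping.lookup m i)"
  unfolding mono_at_def using assms
  by (intro prod.mono_neutral_left) (auto simp: in_keys_iff)

lemma mono_at_add: "mono_at s (m + m') = mono_at s m * mono_at s m'"
proof -
  let ?A = "Poly_Mapping.keys m \<union> Poly_Mapping.keys m'"
  have "mono_at s (m + m') = (\<Prod>i\<in>?A. s i ^ Poly_Mapping.lookup (m + m') i)"
    using keys_add[of m m'] by (intro mono_at_superset) auto
  also have "\<dots> = (\<Prod>i\<in>?A. s i ^ Poly_Mapping.lookup m i) * (\<Prod>i\<in>?A. s i ^ Poly_Mapping.lookup m' i)"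
    by (simp add: lookup_add power_add prod.distrib)
  also have "\<dots> = mono_at s m * mono_at s m'"
    by (simp add: mono_at_superset[of ?A])
  finally show ?thesis .
qed

lemma lsubst_superset:
  assumes "finite A" "Poly_Mapping.keys p \<subseteq> A"
  shows "lsubst s p = (\<Sum>m\<in>A. Const (Poly_Mapping.lookup p m) * mono_at s m)"
  unfolding lsubst_def mono_at_def[symmetric] using assms
  by (intro sum.mono_neutral_left) (auto simp: in_keys_iff)

lemma lsubst_0 [simp]: "lsubst s 0 = 0"
  by (simp add: lsubst_def)

lemma lsubst_add [simp]: "lsubst s (p + q) = lsubst s p + lsubst s q"
proof -
  let ?A = "Poly_Mapping.keys p \<union> Poly_Mapping.keys q"
  have "lsubst s (p + q) = (\<Sum>m\<in>?A. Const (Poly_Mapping.lookup (p + q) m) * mono_at s m)"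
    using keys_add[of p q] by (intro lsubst_superset) auto
  also have "\<dots> = (\<Sum>m\<in>?A. Const (Poly_Mapping.lookup p m) * mono_at s m)
      + (\<Sum>m\<in>?A. Const (Poly_Mapping.lookup q m) * mono_at s m)"
    by (simp add: lookup_add algebra_simps sum.distrib)
  also have "\<dots> = lsubst s p + lsubst s q"
    by (simp add: lsubst_superset[of ?A])
  finally show ?thesis .
qed

lemma lsubst_uminus [simp]: "lsubst s (- p) = - lsubst s p"
  by (metis add_eq_0_iff lsubst_0 lsubst_add right_minus)

lemma lsubst_diff [simp]: "lsubst s (p - q) = lsubst s p - lsubst s q"
  by (metis diff_conv_add_uminus lsubst_add lsubst_uminus)

lemma lsubst_sum [simp]: "lsubst s (sum f A) = (\<Sum>x\<in>A. lsubst s (f x))"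
  by (induction A rule: infinite_finite_induct) auto

lemma lsubst_sum_list [simp]: "lsubst s (sum_list ps) = sum_list (map (lsubst s) ps)"
  by (induction ps) auto

lemma lsubst_single: "lsubst s (Poly_Mapping.single m c) = Const c * mono_at s m"
  by (subst lsubst_superset[of "{m}"]) auto

lemma single_sum_decomp:
  fixes p :: "'a \<Rightarrow>\<^sub>0 'b :: comm_monoid_add"
  shows "p = (\<Sum>m\<in>Poly_Mapping.keys p. Poly_Mapping.single m (Poly_Mapping.lookup p m))"
  by (rule poly_mapping_eqI) (simp add: lookup_sum lookup_single when_def in_keys_iff)

text \<open>A statement additive in \<open>p\<close> need only be checked on monomials. For
  \<open>lsubst_mult\<close> this is done in both factors, which leaves
  \<open>mono_at_add\<close>.\<close>

lemma poly_mapping_single_induct [case_names zero single add]: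
  fixes p :: "'a \<Rightarrow>\<^sub>0 'b :: comm_monoid_add"
  assumes "P 0" "\<And>m c. P (Poly_Mapping.single m c)" "\<And>p q. P p \<Longrightarrow> P q \<Longrightarrow> P (p + q)"
  shows "P p"
proof -
  have "P (\<Sum>m\<in>A. Poly_Mapping.single m (Poly_Mapping.lookup p m))" if "finite A" for A
    using that by induction (auto intro: assms)
  then show ?thesis
    by (subst single_sum_decomp) simp
qed

lemma lsubst_mult [simp]: "lsubst s (p * q) = lsubst s p * lsubst s q"
proof (induction p rule: poly_mapping_single_induct)
  case (single m c)
  show ?case
    by (induction q rule: poly_mapping_single_induct)
      (simp_all add: lsubst_single mult_single mono_at_add algebra_simps)
qed (simp_all add: distrib_right)

lemma lsubst_Const [simp]: "lsubst s (Const c) = Const c"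
  by (subst Const_def) (simp add: lsubst_single mono_at_def)

lemma lsubst_1 [simp]: "lsubst s 1 = 1"
  using lsubst_Const[of s 1] by simp

lemma lsubst_Var [simp]: "lsubst s (Var i) = s i"
  by (simp add: Var_def lsubst_single mono_at_def)

lemma lsubst_power [simp]: "lsubst s (p ^ k) = lsubst s p ^ k"
  by (induction k) auto

lemma lsubst_prod [simp]: "lsubst s (prod f A) = (\<Prod>x\<in>A. lsubst s (f x))"
  by (induction A rule: infinite_finite_induct) auto

lemma lsubst_cong:
  assumes "\<And>i. i \<in> lvars p \<Longrightarrow> s i = t i"
  shows "lsubst s p = lsubst t p"
  unfolding lsubst_def
  by (intro sum.cong refl arg_cong2[of _ _ _ _ "(*)"] prod.cong)
    (subst assms, auto simp: lvars_def)

lemma lsubst_lsubst: "lsubst s (lsubst t p) = lsubst (\<lambda>i. lsubst s (t i)) p"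
  by (simp add: lsubst_def[of t] lsubst_def[of "\<lambda>i. lsubst s (t i)"])

lemma prod_Var_power:
  "finite A \<Longrightarrow> (\<Prod>i\<in>A. Var i ^ f i) = Poly_Mapping.single (\<Sum>i\<in>A. Poly_Mapping.single i (f i)) 1"
proof (induction A rule: finite_induct)
  case (insert i A)
  have "Var i ^ k = Poly_Mapping.single (Poly_Mapping.single i k) 1" for k
    by (induction k) (simp_all add: Var_def mult_single flip: single_add)
  then show ?case
    using insert by (simp add: mult_single)
qed simp

lemma lsubst_Vars [simp]: "lsubst Var p = p"
proof -
  have "mono_at Var m = Poly_Mapping.single m 1" for m
    by (simp add: mono_at_def prod_Var_power flip: single_sum_decomp)
  then show ?thesis
    by (simp add: lsubst_def mono_at_def[symmetric] Const_def mult_single flip: single_sum_decomp)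
qed

section \<open>Variables occurring in a polynomial\<close>

lemma lvars_add: "lvars (p + q) \<subseteq> lvars p \<union> lvars q"
  using keys_add[of p q] by (fastforce simp: lvars_def)

lemma lvars_mult: "lvars (p * q) \<subseteq> lvars p \<union> lvars q"
proof
  fix i assume "i \<in> lvars (p * q)"
  then obtain m where "m \<in> Poly_Mapping.keys (p * q)" "i \<in> Poly_Mapping.keys m"
    by (auto simp: lvars_def)
  with keys_mult[of p q] obtain m1 m2 where "m1 \<in> Poly_Mapping.keys p" "m2 \<in> Poly_Mapping.keys q" "m
      = m1 + m2"
    by blast
  with \<open>i \<in> Poly_Mapping.keys m\<close> keys_add[of m1 m2] show "i \<in> lvars p \<union> lvars q"
    by (auto simp: lvars_def)
qed

lemma lvars_simps [simp]: "lvars 0 = {}" "lvars 1 = {}" "lvars (Const c) = {}" "lvars (Var i) = {i}"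
  by (auto simp: lvars_def Const_def Var_def)

lemma lvars_sum: "(\<And>x. x \<in> A \<Longrightarrow> lvars (f x) \<subseteq> S) \<Longrightarrow> lvars (sum f A) \<subseteq> S"
  using lvars_add by (induction A rule: infinite_finite_induct) (simp_all, blast)

lemma lvars_prod: "(\<And>x. x \<in> A \<Longrightarrow> lvars (f x) \<subseteq> S) \<Longrightarrow> lvars (prod f A) \<subseteq> S"
  using lvars_mult by (induction A rule: infinite_finite_induct) (simp_all, blast)

lemma lvars_power: "lvars (p ^ k) \<subseteq> lvars p"
  using lvars_mult by (induction k) (simp_all, blast)

text \<open>The bound comes from \<open>s\<close> alone. Hence a polynomial fixed by a substitution
  with values in the variables of \<open>S\<close> involves only these variables itself.\<close>

lemma lvars_lsubst: "(\<And>i. lvars (s i) \<subseteq> S) \<Longrightarrow> lvars (lsubst s p) \<subseteq> S"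
  unfolding lsubst_def
  by (intro lvars_sum order.trans[OF lvars_mult] Un_least lvars_prod order.trans[OF lvars_power]) auto


section \<open>Alternating sums over the entries of a list\<close>

text \<open>Recursion on the list replaces index calculations with omitted entries;
  \<open>alt_sum1_conv\<close> and \<open>alt_sum2_conv\<close> recover the usual sums. The function
  argument accumulates the entries kept, so the inductions generalize over it.\<close>

primrec alt_sum1 :: "('a \<Rightarrow> 'a list \<Rightarrow> 'b :: comm_ring_1) \<Rightarrow> 'a list \<Rightarrow> 'b" where
  "alt_sum1 C [] = 0"
| "alt_sum1 C (a # ps) = C a ps - alt_sum1 (\<lambda>x r. C x (a # r)) ps"

text \<open>If both chosen entries lie in \<open>ps\<close>, both indices shift by 1 and the sign
  \<open>(- 1) ^ (i + j)\<close> is kept; if \<open>a\<close> is chosen, only the other index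
  shifts, hence the minus sign.\<close>

primrec alt_sum2 :: "('a \<Rightarrow> 'a \<Rightarrow> 'a list \<Rightarrow> 'b :: comm_ring_1) \<Rightarrow> 'a list \<Rightarrow> 'b" where
  "alt_sum2 B [] = 0"
| "alt_sum2 B (a # ps) = alt_sum2 (\<lambda>x y r. B x y (a # r)) ps - alt_sum1 (B a) ps"

lemma alt_sum1_conv:
  "alt_sum1 C ps = (\<Sum>j<length ps. (- 1) ^ j * C (ps ! j) (nths ps (- {j})))"
proof (induction ps arbitrary: C)
  case (Cons a ps)
  have *: "{i. Suc i \<in> - {0}} = UNIV" "{i. Suc i \<in> - {Suc j}} = - {j}" for j
    by auto
  have "nths (a # ps) (- {0}) = ps" "nths (a # ps) (- {Suc j}) = a # nths ps (- {j})" for j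
    by (simp_all only: nths_Cons *) (simp_all add: nths_all)
  then show ?case
    by (simp add: Cons.IH sum.lessThan_Suc_shift sum_negf del: sum.lessThan_Suc)
qed simp

lemma omit2_Cons:
  "omit2 0 (Suc j) (a # ps) = nths ps (- {j})"
  "omit2 (Suc i) (Suc j) (a # ps) = a # omit2 i j ps"
proof -
  have "{k. Suc k \<in> - {0, Suc j}} = - {j}" "{k. Suc k \<in> - {Suc i, Suc j}} = - {i, j}"
    by auto
  then show "omit2 0 (Suc j) (a # ps) = nths ps (- {j})"
    "omit2 (Suc i) (Suc j) (a # ps) = a # omit2 i j ps"
    by (simp_all add: omit2_def nths_Cons)
qed

lemma alt_sum2_conv:
  "alt_sum2 B ps = (\<Sum>j<length ps. \<Sum>i<j. (- 1) ^ (i + j) * B (ps ! i) (ps ! j) (omit2 i j ps))"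
proof (induction ps arbitrary: B)
  case (Cons a ps)
  show ?case
    by (simp add: Cons.IH alt_sum1_conv sum.lessThan_Suc_shift omit2_Cons sum_subtractf sum_negf
        del: sum.lessThan_Suc)
qed simp

lemma alt_sum1_lincomb:
  "alt_sum1 (\<lambda>x r. \<alpha> * C x r + \<beta> * D x r) ps = \<alpha> * alt_sum1 C ps + \<beta> * alt_sum1 D ps"
  by (induction ps arbitrary: C D) (simp_all add: algebra_simps)

lemma alt_sum2_lincomb:
  "alt_sum2 (\<lambda>x y r. \<alpha> * B x y r + \<beta> * D x y r) ps = \<alpha> * alt_sum2 B ps + \<beta> * alt_sum2 D ps"
  by (induction ps arbitrary: B D) (simp_all add: alt_sum1_lincomb algebra_simps)

lemma alt_sum1_uminus: "alt_sum1 (\<lambda>x r. - C x r) ps = - alt_sum1 C ps"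
  by (induction ps arbitrary: C) simp_all

lemma alt_sum2_uminus: "alt_sum2 (\<lambda>x y r. - B x y r) ps = - alt_sum2 B ps"
  by (induction ps arbitrary: B) (simp_all add: alt_sum1_uminus)

text \<open>The replaced entry is either taken out or left in the rest, and the two hypotheses treat
  these cases. \<open>alt_sum2_linear\<close> has a third one, since two entries are taken
  out.\<close>

lemma alt_sum1_linear:
  assumes "\<And>r. C a r = \<alpha> * C b r + \<beta> * C c r"
    and "\<And>x u v. C x (u @ a # v) = \<alpha> * C x (u @ b # v) + \<beta> * C x (u @ c # v)"
  shows "alt_sum1 C (u @ a # v) = \<alpha> * alt_sum1 C (u @ b # v) + \<beta> * alt_sum1 C (u @ c # v)"
  using assms
proof (induction u arbitrary: C)
  case Nil
  have "alt_sum1 (\<lambda>x r. C x (a # r)) v = alt_sum1 (\<lambda>x r. \<alpha> * C x (b # r) + \<beta> * C x (c # r)) v"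
    using Nil(2)[of _ "[]"] by simp
  then show ?case
    by (simp add: Nil(1) alt_sum1_lincomb algebra_simps)
next
  case (Cons d u)
  have "alt_sum1 (\<lambda>x r. C x (d # r)) (u @ a # v) = \<alpha> * alt_sum1 (\<lambda>x r. C x (d # r)) (u @ b # v)
      + \<beta> * alt_sum1 (\<lambda>x r. C x (d # r)) (u @ c # v)"
    using Cons.prems(2)[of _ "d # _"] by (intro Cons.IH) (auto simp: Cons.prems(1))
  then show ?case
    by (simp add: Cons.prems(2) algebra_simps)
qed

lemma alt_sum2_linear:
  assumes "\<And>y r. B a y r = \<alpha> * B b y r + \<beta> * B c y r"
    and "\<And>x r. B x a r = \<alpha> * B x b r + \<beta> * B x c r"
    and "\<And>x y u v. B x y (u @ a # v) = \<alpha> * B x y (u @ b # v) + \<beta> * B x y (u @ c # v)"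
  shows "alt_sum2 B (u @ a # v) = \<alpha> * alt_sum2 B (u @ b # v) + \<beta> * alt_sum2 B (u @ c # v)"
  using assms
proof (induction u arbitrary: B)
  case Nil
  have "alt_sum2 (\<lambda>x y r. B x y (a # r)) v
      = alt_sum2 (\<lambda>x y r. \<alpha> * B x y (b # r) + \<beta> * B x y (c # r)) v"
    using Nil(3)[of _ _ "[]"] by simp
  moreover have "alt_sum1 (B a) v = alt_sum1 (\<lambda>y r. \<alpha> * B b y r + \<beta> * B c y r) v"
    using Nil(1) by presburger
  ultimately show ?case
    by (simp add: alt_sum1_lincomb alt_sum2_lincomb algebra_simps)
next
  case (Cons d u)
  have "alt_sum2 (\<lambda>x y r. B x y (d # r)) (u @ a # v) = \<alpha> * alt_sum2 (\<lambda>x y r. B x y (d # r)) (u @ b # v)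
      + \<beta> * alt_sum2 (\<lambda>x y r. B x y (d # r)) (u @ c # v)"
    using Cons.prems(3)[of _ _ "d # _"] by (intro Cons.IH) (auto simp: Cons.prems(1,2))
  moreover have "alt_sum1 (B d) (u @ a # v)
      = \<alpha> * alt_sum1 (B d) (u @ b # v) + \<beta> * alt_sum1 (B d) (u @ c # v)"
    by (intro alt_sum1_linear) (auto simp: Cons.prems)
  ultimately show ?case
    by (simp add: algebra_simps)
qed

section \<open>Alternating functions of lists\<close>

definition alternating :: "('a list \<Rightarrow> 'b :: comm_ring_1) \<Rightarrow> bool" where
  "alternating F \<longleftrightarrow> (\<forall>u a b v. F (u @ a # b # v) = - F (u @ b # a # v))"

lemma alternatingD: "alternating F \<Longrightarrow> F (u @ a # b # v) = - F (u @ b # a # v)"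
  unfolding alternating_def by (erule allE)+

lemma alternating_Cons: "alternating F \<Longrightarrow> alternating (\<lambda>r. F (a # r))"
  unfolding alternating_def
proof (intro allI)
  fix u b c v
  assume "\<forall>u a b v. F (u @ a # b # v) = - F (u @ b # a # v)"
  from this[rule_format, of "a # u" b c v] have "F ((a # u) @ b # c # v) = - F ((a # u) @ c # b # v)" .
  then show "F (a # u @ b # c # v) = - F (a # u @ c # b # v)"
    by simp
qed

text \<open>If neither swapped entry is taken out, \<open>C x\<close> changes sign. The two terms
  that take out \<open>a\<close> or \<open>b\<close> are exchanged by the swap and carry opposite
  signs.\<close>

lemma alternating_alt_sum1:
  assumes "\<And>x. alternating (C x)"
  shows "alternating (alt_sum1 C)"
proof -
  have "alt_sum1 C (u @ a # b # v) = - alt_sum1 C (u @ b # a # v)" for u a b v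
    using assms
  proof (induction u arbitrary: C)
    case Nil
    have "C x (a # b # r) = - C x (b # a # r)" for x r
      using alternatingD[OF Nil[of x], of "[]" a b r] by simp
    then have "alt_sum1 (\<lambda>x r. C x (a # b # r)) v = - alt_sum1 (\<lambda>x r. C x (b # a # r)) v"
      by (simp add: alt_sum1_uminus)
    then show ?case
      by simp
  next
    case (Cons d u)
    have "alt_sum1 (\<lambda>x r. C x (d # r)) (u @ a # b # v) = - alt_sum1 (\<lambda>x r. C x (d # r)) (u @ b # a # v)"
      by (rule Cons.IH) (rule alternating_Cons[OF Cons.prems])
    then show ?case
      using alternatingD[OF Cons.prems[of d], of u a b v] by simp
  qed
  then show ?thesis
    unfolding alternating_def by (intro allI)
qed

text \<open>As for \<open>alt_sum1\<close>, with one more case: when both swapped entries are taken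
  out, the sign comes from the skew-symmetry of \<open>B\<close> in its first two arguments.\<close>

lemma alternating_alt_sum2:
  assumes "\<And>x y r. B x y r = - B y x r" and "\<And>x y. alternating (B x y)"
  shows "alternating (alt_sum2 B)"
proof -
  have "alt_sum2 B (u @ a # b # v) = - alt_sum2 B (u @ b # a # v)" for u a b v
    using assms
  proof (induction u arbitrary: B)
    case Nil
    have "B x y (a # b # r) = - B x y (b # a # r)" for x y r
      using alternatingD[OF Nil(2)[of x y], of "[]" a b r] by simp
    then have "alt_sum2 (\<lambda>x y r. B x y (a # b # r)) v = - alt_sum2 (\<lambda>x y r. B x y (b # a # r)) v"
      by (simp add: alt_sum2_uminus)
    then show ?case
      using Nil(1)[of a b v] by (simp add: algebra_simps)
  next
    case (Cons d u)
    have "alt_sum2 (\<lambda>x y r. B x y (d # r)) (u @ a # b # v)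
        = - alt_sum2 (\<lambda>x y r. B x y (d # r)) (u @ b # a # v)"
      by (rule Cons.IH) (rule Cons.prems(1), rule alternating_Cons[OF Cons.prems(2)])
    then show ?case
      using alternatingD[OF alternating_alt_sum1, of "B d" u a b v] Cons.prems(2) by simp
  qed
  then show ?thesis
    unfolding alternating_def by (intro allI)
qed

lemma alternating_move:
  "alternating F \<Longrightarrow> F (u @ a # v @ w) = (- 1) ^ length v * F (u @ v @ a # w)"
proof (induction v arbitrary: u)
  case (Cons b v)
  from Cons.IH[of "u @ [b]"] show ?case
    using alternatingD[OF Cons.prems, of u a b "v @ w"] by (simp add: Cons.prems)
qed simp

lemma alternating_swap:
  assumes "alternating F"
  shows "F (u @ a # v @ b # w) = - F (u @ b # v @ a # w)"
  \<comment> \<open>Both lists are brought to \<open>u @ v @ b # a # w\<close>, by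
    \<open>length v + 1\<close> and by \<open>length v\<close> adjacent swaps.\<close>
  using alternating_move[OF assms, of u a "v @ [b]" w] alternating_move[OF assms, of u b v "a # w"]
  by simp

lemma permute_list_transpose:
  "i < length xs \<Longrightarrow> j < length xs \<Longrightarrow> permute_list (transpose i j) xs = xs[i := xs ! j, j := xs ! i]"
  by (rule nth_equalityI) (auto simp: permute_list_def nth_list_update transpose_def)

text \<open>The definition of \<open>alternating\<close> mentions adjacent swaps only, which suits
  induction on lists. As transpositions generate the permutations, the sign rule demanded of
  cochains follows.\<close>

lemma alternating_permute_list:
  assumes alt: "alternating F" and "p permutes {..<length ps}"
  shows "F (permute_list p ps) = of_int (sign p) * F ps"
  using finite_lessThan assms(2)
proof (induction rule: permutes_rev_induct)
  case (swap i j p)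
  have transpose: "F (permute_list (transpose i j) qs) = - F qs" if "i < j" "j < length qs" for i j qs
  proof -
    obtain u v w x y where qs: "qs = u @ x # v @ y # w"
      and len: "i = length u" "j = Suc (length u + length v)"
    proof
      have *: "Suc (i + (j - Suc i)) = j" "Suc (j - Suc i + i) = j"
        using \<open>i < j\<close> by auto
      have "drop (Suc i) qs = take (j - Suc i) (drop (Suc i) qs) @ qs ! j # drop (Suc j) qs"
        using \<open>i < j\<close> \<open>j < length qs\<close> id_take_nth_drop[of "j - Suc i" "drop (Suc i) qs"] by (simp add: *)
      then show "qs = take i qs @ qs ! i # take (j - Suc i) (drop (Suc i) qs) @ qs ! j # drop (Suc j) qs"
        using \<open>i < j\<close> \<open>j < length qs\<close> id_take_nth_drop[of i qs] by simp
    qed (use \<open>i < j\<close> \<open>j < length qs\<close> in auto)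
    have "permute_list (transpose i j) qs = u @ y # v @ x # w"
      by (simp add: permute_list_transpose qs len nth_append list_update_append)
    then show ?thesis
      using alternating_swap[OF alt, of u y v x w] by (simp add: qs)
  qed
  have "F (permute_list (p \<circ> transpose i j) ps) = F (permute_list (transpose i j) (permute_list p ps))"
    using swap by (simp add: permute_list_compose permutes_swap_id)
  also have "\<dots> = - F (permute_list p ps)"
    \<comment> \<open>Either of \<open>i\<close> and \<open>j\<close> may be the smaller one, hence
      both instances.\<close>
    using transpose[of i j "permute_list p ps"] transpose[of j i "permute_list p ps"] swap
    by (cases "i < j") (auto simp: transpose_commute)
  also have "\<dots> = of_int (sign (p \<circ> transpose i j)) * F ps"
    using swap by (simp add: sign_compose sign_swap_id permutation_swap_id permutes_imp_permutation[OF finite_lessThan])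
  finally show ?case .
qed simp

text \<open>With \<open>lsubst s\<close> for \<phi> and \<open>apsnd (lsubst s)\<close> for
  \<open>f\<close>, this and \<open>alt_sum2_hom\<close> make the differential commute with
  substitutions.\<close>

lemma alt_sum1_hom:
  assumes "\<phi> 0 = 0" "\<And>p q. \<phi> (p - q) = \<phi> p - \<phi> q" "\<And>x r. \<phi> (C x r) = D (f x) (map f r)"
  shows "\<phi> (alt_sum1 C ps) = alt_sum1 D (map f ps)"
  using assms(3) by (induction ps arbitrary: C D) (simp_all add: assms(1,2))

lemma alt_sum2_hom:
  assumes "\<phi> 0 = 0" "\<And>p q. \<phi> (p - q) = \<phi> p - \<phi> q" "\<And>x y r. \<phi> (B x y r) = D (f x) (f y) (map f r)"
  shows "\<phi> (alt_sum2 B ps) = alt_sum2 D (map f ps)"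
  using assms(3)
  by (induction ps arbitrary: B D) (simp_all add: assms(1,2) alt_sum1_hom[of \<phi>])


section \<open>Evaluation of polynomials and of brackets\<close>

text \<open>The map \<open>h\<close> will be \<open>Const\<close> for \<open>evp\<close> and
  \<open>\<lambda>f. evp f (- u)\<close> for \<open>evpp\<close>, the two levels of the nested
  polynomials.\<close>

lemma poly_map_poly_add:
  assumes "h 0 = 0" "\<And>a b. h (a + b) = h a + h b"
  shows "poly (map_poly h (f + g)) x = poly (map_poly h f) x + poly (map_poly h g) x"
  by (induction f g rule: poly_induct2) (simp_all add: map_poly_pCons assms algebra_simps)

lemma poly_map_poly_mult:
  fixes h :: "'a :: comm_ring_1 \<Rightarrow> 'b :: comm_ring_1"
  assumes "h 0 = 0" "\<And>a b. h (a + b) = h a + h b" "\<And>a b. h (a * b) = h a * h b"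
  shows "poly (map_poly h (f * g)) x = poly (map_poly h f) x * poly (map_poly h g) x"
proof (induction f)
  case (pCons c f)
  have "poly (map_poly h (smult c g)) x = h c * poly (map_poly h g) x"
    by (induction g) (simp_all add: map_poly_pCons assms algebra_simps)
  then show ?case
    using pCons by (simp add: map_poly_pCons poly_map_poly_add[of h] assms algebra_simps)
qed simp

definition evp :: "complex poly \<Rightarrow> lpoly \<Rightarrow> lpoly" where
  "evp f q = poly (map_poly Const f) q"

lemma evp_simps [simp]:
  "evp 0 q = 0" "evp 1 q = 1" "evp (f + g) q = evp f q + evp g q" "evp (f * g) q = evp f q * evp g q"
  "evp (pCons c f) q = Const c + q * evp f q"
  by (simp_all add: evp_def poly_map_poly_add poly_map_poly_mult map_poly_pCons map_poly_1')

lemma lsubst_evp [simp]: "lsubst s (evp f q) = evp f (lsubst s q)"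
  by (induction f) simp_all

text \<open>
  Since \<open>\<partial>\<close> acts on an argument of a cochain by minus the variable, an element of \<open>SV[\<lambda>]\<close> at the
  variable \<open>u\<close> is evaluated by \<open>\<lambda> \<mapsto> t\<close>, \<open>\<partial> \<mapsto> - u\<close>.
\<close>

definition evpp :: "complex poly poly \<Rightarrow> lpoly \<Rightarrow> lpoly \<Rightarrow> lpoly" where
  "evpp b t u = poly (map_poly (\<lambda>f. evp f (- u)) b) t"

lemma evpp_simps [simp]:
  "evpp 0 t u = 0" "evpp 1 t u = 1" "evpp (b + c) t u = evpp b t u + evpp c t u"
  "evpp (b * c) t u = evpp b t u * evpp c t u"
  "evpp (pCons f b) t u = evp f (- u) + t * evpp b t u"
  by (simp_all add: evpp_def poly_map_poly_add poly_map_poly_mult map_poly_pCons map_poly_1')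

lemma evpp_sum [simp]: "evpp (sum b A) t u = (\<Sum>x\<in>A. evpp (b x) t u)"
  by (induction A rule: infinite_finite_induct) simp_all

lemma evpp_uminus [simp]: "evpp (- b) t u = - evpp b t u"
  by (metis add_eq_0_iff evpp_simps(1,3) right_minus)

lemma evpp_numeral_2 [simp]: "evpp 2 t u = 2"
  using evpp_simps(3)[of 1 1 t u] by simp

lemma evpp_gens [simp]:
  "evpp lam t u = t" "evpp del t u = - u" "evpp (cst c) t u = Const c"
  by (simp_all add: lam_def del_def cst_def)

lemma evpp_poly_at [simp]: "evpp (poly_at f p) t u = evp f (evpp p t u)"
  by (induction f) simp_all

lemma lsubst_evpp [simp]: "lsubst s (evpp b t u) = evpp b (lsubst s t) (lsubst s u)"
  by (induction b) simp_all

text \<open>A bracket of arguments with variables \<open>p\<close> and \<open>q\<close> sits in a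
  slot with variable \<open>p + q\<close>, so \<partial> is evaluated at
  \<open>- (p + q)\<close>.\<close>

definition struct_poly :: "gen \<Rightarrow> gen \<Rightarrow> gen \<Rightarrow> lpoly \<Rightarrow> lpoly \<Rightarrow> lpoly" where
  "struct_poly X Z W p q = evpp (gen_bracket X Z $ W) p (p + q)"

text \<open>Skew-symmetry of the \<lambda>-bracket on generators: for \<lambda> = \<open>p\<close>
  and \<partial> = \<open>- (p + q)\<close>, the expression -\<lambda>-\<partial> is
  \<open>q\<close>.\<close>

lemma struct_poly_skew: "struct_poly X Z W p q = - struct_poly Z X W q p"
proof -
  \<comment> \<open>For the pair of \<open>GenL\<close> and \<open>GenY\<close> the two constants
    must be related before the terms can cancel.\<close>
  have "Const (3/2) = 1 + Const (1/2)"
    using Const_simps(3)[of 1 "1/2"] by (simp del: Const_simps(3))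
  then show ?thesis
    by (cases X; cases Z) (simp_all add: struct_poly_def axis_def algebra_simps)
qed

text \<open>At \<lambda> = 0 the bracket with \<open>GenL\<close> is \<partial> on each generator,
  and \<partial> is evaluated at \<open>- (0 + q)\<close>.\<close>

lemma struct_poly_L_0: "struct_poly GenL Z W 0 q = (if W = Z then - q else 0)"
  by (cases Z) (auto simp: struct_poly_def axis_def)

text \<open>The sesquilinear factors f(-\<lambda>) and g(\<partial>+\<lambda>) become f(-p) and
  g(-q) at \<lambda> = p, \<partial> = -(p+q), so the two arguments enter symmetrically.\<close>

definition bracket_poly :: "sv \<times> lpoly \<Rightarrow> sv \<times> lpoly \<Rightarrow> gen \<Rightarrow> lpoly" where
  "bracket_poly a b W = (\<Sum>X\<in>UNIV. \<Sum>Z\<in>UNIV.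
     evp (fst a $ X) (- snd a) * evp (fst b $ Z) (- snd b) * struct_poly X Z W (snd a) (snd b))"

lemma evpp_sv_bracket: "evpp (sv_bracket x y $ W) p (p + q) = bracket_poly (x, p) (y, q) W"
  by (simp add: sv_bracket_def bracket_poly_def struct_poly_def sum_component)

lemma bracket_poly_skew: "bracket_poly a b W = - bracket_poly b a W"
  unfolding bracket_poly_def
  by (subst sum.swap) (simp add: struct_poly_skew[of _ _ _ "snd a"] sum_negf mult_ac)

lemma bracket_poly_linear:
  "bracket_poly (f *s x + h *s y, p) b W
      = evp f (- p) * bracket_poly (x, p) b W + evp h (- p) * bracket_poly (y, p) b W"
  by (simp add: bracket_poly_def sum_distrib_left algebra_simps sum.distrib)

lemma lsubst_bracket_poly: "lsubst s (bracket_poly a b W)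
    = bracket_poly (apsnd (lsubst s) a) (apsnd (lsubst s) b) W"
  by (simp add: bracket_poly_def struct_poly_def)


section \<open>Cochains as functions of pairs of an argument and a variable\<close>

text \<open>
  A cochain with its variables substituted is a function of a list of pairs \<open>(a\<^sub>i, p\<^sub>i)\<close>, where \<open>p\<^sub>i\<close>
  is the polynomial put for \<open>\<lambda>\<^sub>i\<close>. Permuting arguments and variables simultaneously then just
  permutes the list.
\<close>

definition polyform :: "((sv \<times> lpoly) list \<Rightarrow> lpoly) \<Rightarrow> bool" where
  "polyform G \<longleftrightarrow> alternating G \<and>
     (\<forall>u v f h x y p. G (u @ (f *s x + h *s y, p) # v) =
        evp f (- p) * G (u @ (x, p) # v) + evp h (- p) * G (u @ (y, p) # v)) \<and>
     (\<forall>s ps. lsubst s (G ps) = G (map (apsnd (lsubst s)) ps))"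

lemma polyform_alt: "polyform G \<Longrightarrow> alternating G"
  unfolding polyform_def by blast

lemma polyform_lin:
  "polyform G \<Longrightarrow> G (u @ (f *s x + h *s y, p) # v) =
     evp f (- p) * G (u @ (x, p) # v) + evp h (- p) * G (u @ (y, p) # v)"
  unfolding polyform_def by blast

lemma polyform_nat: "polyform G \<Longrightarrow> lsubst s (G ps) = G (map (apsnd (lsubst s)) ps)"
  unfolding polyform_def by blast

lemma polyformI:
  assumes "alternating G"
    and "\<And>u v f h x y p. G (u @ (f *s x + h *s y, p) # v) =
        evp f (- p) * G (u @ (x, p) # v) + evp h (- p) * G (u @ (y, p) # v)"
    and "\<And>s ps. lsubst s (G ps) = G (map (apsnd (lsubst s)) ps)"
  shows "polyform G"
  unfolding polyform_def by (intro conjI allI assms)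

text \<open>Compatibility with substitutions survives because the contracted variable is 0, which
  every \<open>lsubst s\<close> fixes.\<close>

lemma polyform_Cons_0:
  assumes "polyform G"
  shows "polyform (\<lambda>r. G ((x, 0) # r))"
proof (rule polyformI)
  show "alternating (\<lambda>r. G ((x, 0) # r))"
    by (rule alternating_Cons[OF polyform_alt[OF assms]])
qed (use polyform_lin[OF assms, of "(x, 0) # _"] in \<open>simp_all add: polyform_nat[OF assms]\<close>)

lemma polyform_add:
  assumes "polyform G" "polyform H"
  shows "polyform (\<lambda>ps. G ps + H ps)"
proof (rule polyformI)
  show "alternating (\<lambda>ps. G ps + H ps)"
    unfolding alternating_def
    by (intro allI, subst alternatingD[OF polyform_alt[OF assms(1)]],
        subst alternatingD[OF polyform_alt[OF assms(2)]]) simp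
qed (simp_all add: polyform_lin[OF assms(1)] polyform_lin[OF assms(2)] polyform_nat[OF assms(1)]
      polyform_nat[OF assms(2)] algebra_simps)

text \<open>The sum of the variables is symmetric and compatible with substitutions. The case
  \<open>e = 1\<close> serves \<partial>, the case \<open>e = 0\<close> scalar multiples.\<close>

lemma polyform_mult:
  assumes "polyform G"
  shows "polyform (\<lambda>ps. (Const c + Const e * sum_list (map snd ps)) * G ps)"
proof (rule polyformI)
  show "alternating (\<lambda>ps. (Const c + Const e * sum_list (map snd ps)) * G ps)"
    unfolding alternating_def
    by (intro allI, subst alternatingD[OF polyform_alt[OF assms]]) (simp add: algebra_simps)
qed (simp_all add: polyform_lin[OF assms] polyform_nat[OF assms] o_def algebra_simps)

text \<open>The factor \<open>1 *s\<close> gives both sums the shape \<open>f *s x + h *s y\<close>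
  to which \<open>polyform_lin\<close> applies.\<close>

lemma vec_expand: "(x :: sv)
    = x $ GenL *s axis GenL 1 + 1 *s (x $ GenM *s axis GenM 1 + x $ GenY *s axis GenY 1)"
proof -
  have "x $ W = (x $ GenL *s axis GenL 1
      + 1 *s (x $ GenM *s axis GenM 1 + x $ GenY *s axis GenY 1)) $ W" for W
    by (cases W) (simp_all add: axis_def)
  then show ?thesis
    unfolding vec_eq_iff by blast
qed

lemma UNIV_gen: "(UNIV :: gen set) = {GenL, GenM, GenY}"
  by (auto intro: gen.exhaust)

lemma polyform_expand:
  assumes "polyform G"
  shows "G (u @ (x, p) # v) = (\<Sum>W\<in>UNIV. evp (x $ W) (- p) * G (u @ (axis W 1, p) # v))"
  by (rule trans[OF arg_cong[OF vec_expand]]) (simp only: polyform_lin[OF assms] UNIV_gen, simp)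

section \<open>The differential on functions of pairs\<close>

definition differential_term :: "((sv \<times> lpoly) list \<Rightarrow> lpoly) \<Rightarrow> sv \<times> lpoly \<Rightarrow> sv \<times> lpoly \<Rightarrow> (sv \<times> lpoly) list \<Rightarrow> lpoly" where
  "differential_term G a b r = (\<Sum>W\<in>UNIV. bracket_poly a b W * G ((axis W 1, snd a + snd b) # r))"

definition differential_form :: "((sv \<times> lpoly) list \<Rightarrow> lpoly) \<Rightarrow> (sv \<times> lpoly) list \<Rightarrow> lpoly" where
  "differential_form G = alt_sum2 (differential_term G)"

lemma differential_term_skew: "differential_term G a b r = - differential_term G b a r"
  unfolding differential_term_def by (subst bracket_poly_skew) (simp add: sum_negf add.commute)

lemma differential_term_linear1:
  "differential_term G (f *s x + h *s y, p) b r
      = evp f (- p) * differential_term G (x, p) b r + evp h (- p) * differential_term G (y, p) b r"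
  by (simp add: differential_term_def bracket_poly_linear sum_distrib_left algebra_simps sum.distrib)

lemma differential_term_linear2:
  "differential_term G a (f *s x + h *s y, p) r
      = evp f (- p) * differential_term G a (x, p) r + evp h (- p) * differential_term G a (y, p) r"
  by (simp add: differential_term_skew[of G a] differential_term_linear1)

text \<open>This contains the fact that the differential of a cochain is a cochain: skew-symmetry
  and sesquilinearity of the bracket pass to the sum over pairs.\<close>

lemma polyform_differential_form:
  assumes "polyform G"
  shows "polyform (differential_form G)"
proof (rule polyformI)
  have "differential_term G x y (u @ a # b # v)
      = - differential_term G x y (u @ b # a # v)" for x y a b u v
    using alternatingD[OF alternating_Cons[OF polyform_alt[OF assms]], of _ u a b v]
    by (simp add: differential_term_def sum_negf)
  then show "alternating (differential_form G)"
    unfolding differential_form_def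
    by (intro alternating_alt_sum2 differential_term_skew) (unfold alternating_def, intro allI)
  show "differential_form G (u @ (f *s x + h *s y, p) # v) =
      evp f (- p) * differential_form G (u @ (x, p) # v)
          + evp h (- p) * differential_form G (u @ (y, p) # v)" for u v f h x y p
    unfolding differential_form_def
  proof (rule alt_sum2_linear)
    show "differential_term G d e (u @ (f *s x + h *s y, p) # v) =
      evp f (- p) * differential_term G d e (u @ (x, p) # v)
          + evp h (- p) * differential_term G d e (u @ (y, p) # v)" for d e u v
      using polyform_lin[OF assms, of "_ # u"]
      by (simp add: differential_term_def sum_distrib_left algebra_simps sum.distrib)
  qed (simp_all add: differential_term_linear1 differential_term_linear2)
  show "lsubst s (differential_form G ps) = differential_form G (map (apsnd (lsubst s)) ps)" for s ps
    unfolding differential_form_def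
    by (rule alt_sum2_hom) (simp_all add: differential_term_def lsubst_bracket_poly polyform_nat[OF assms])
qed

section \<open>Cartan's formula for the contraction with L at 0\<close>

lemma alt_sum1_weighted:
  fixes G :: "'a list \<Rightarrow> 'b :: comm_ring_1"
  assumes "alternating G"
  shows "alt_sum1 (\<lambda>x r. w x * G (x # r)) ps = sum_list (map w ps) * G ps"
  using assms
proof (induction ps arbitrary: G)
  case (Cons a ps)
  \<comment> \<open>Moving \<open>x\<close> back to its place costs exactly the sign attached by
    \<open>alt_sum1\<close>, so every summand becomes a weight times the same value of
    \<open>G\<close>.\<close>
  have "G (x # a # r) = - G (a # x # r)" for x r
    using alternatingD[OF Cons.prems, of "[]" x a r] by simp
  then have "alt_sum1 (\<lambda>x r. w x * G (x # a # r)) ps = - alt_sum1 (\<lambda>x r. w x * G (a # x # r)) ps"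
    by (simp flip: alt_sum1_uminus)
  also have "\<dots> = - (sum_list (map w ps) * G (a # ps))"
    using Cons.IH[OF alternating_Cons[OF Cons.prems], of a] by simp
  finally show ?case
    by (simp add: algebra_simps)
qed simp

text \<open>Pairs inside \<open>ps\<close> give minus the differential of the contraction, as
  \<open>e\<close> has to pass the bracket. A pair of \<open>e\<close> and \<open>a\<close> gives
  minus the variable of \<open>a\<close>, and this sign cancels against the one before
  \<open>alt_sum1\<close> in \<open>alt_sum2\<close>.\<close>

lemma cartan:
  assumes "polyform G"
  defines "e \<equiv> (axis GenL 1, 0) :: sv \<times> lpoly"
  shows "differential_form G (e # ps) + differential_form (\<lambda>r. G (e # r)) ps
      = sum_list (map snd ps) * G ps"
proof -
  have "differential_term G x y (e # r) = - differential_term (\<lambda>r. G (e # r)) x y r" for x y r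
  proof -
    have "G (b # e # r) = - G (e # b # r)" for b
      using alternatingD[OF polyform_alt[OF assms(1)], of "[]" b e r] by simp
    then show ?thesis
      by (simp add: differential_term_def sum_negf)
  qed
  then have 1: "alt_sum2 (\<lambda>x y r. differential_term G x y (e # r)) ps
      = - differential_form (\<lambda>r. G (e # r)) ps"
    by (simp add: differential_form_def alt_sum2_uminus)
  have 2: "differential_term G e a r = - (snd a * G (a # r))" for a r
  proof -
    have bracket_poly: "bracket_poly e a W = - (snd a * evp (fst a $ W) (- snd a))" for W
      by (cases W) (simp_all add: bracket_poly_def e_def struct_poly_L_0 axis_def UNIV_gen mult.commute)
    have "G (a # r) = (\<Sum>W\<in>UNIV. evp (fst a $ W) (- snd a) * G ((axis W 1, snd a) # r))"
      using polyform_expand[OF assms(1), of "[]" "fst a" "snd a" r] by simp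
    then show ?thesis
      by (simp add: differential_term_def bracket_poly sum_negf sum_distrib_left mult_ac) (simp add: e_def)
  qed
  have "alt_sum1 (differential_term G e) ps = alt_sum1 (\<lambda>a r. - (snd a * G (a # r))) ps"
    using 2 by presburger
  also have "\<dots> = - (sum_list (map snd ps) * G ps)"
    by (simp add: alt_sum1_uminus alt_sum1_weighted polyform_alt[OF assms(1)])
  finally show ?thesis
    using 1 by (simp add: differential_form_def)
qed

text \<open>The entry taken out and the rest have the same total weight in every summand. An
  arbitrary \<phi> lets the induction absorb the weight of the head.\<close>

lemma alt_sum1_sumweight:
  fixes w :: "'a \<Rightarrow> 'c :: comm_monoid_add"
  assumes "\<And>x r. C' x r = \<phi> (w x + sum_list (map w r)) * C x r"
  shows "alt_sum1 C' ps = \<phi> (sum_list (map w ps)) * alt_sum1 C ps"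
  using assms
proof (induction ps arbitrary: \<phi> C C')
  case (Cons a ps)
  have "alt_sum1 (\<lambda>x r. C' x (a # r)) ps
      = \<phi> (w a + sum_list (map w ps)) * alt_sum1 (\<lambda>x r. C x (a # r)) ps"
    by (rule Cons.IH) (simp add: Cons.prems add_ac)
  then show ?case
    by (simp add: Cons.prems algebra_simps)
qed simp

lemma alt_sum2_sumweight:
  fixes w :: "'a \<Rightarrow> 'c :: comm_monoid_add"
  assumes "\<And>x y r. B' x y r = \<phi> (w x + w y + sum_list (map w r)) * B x y r"
  shows "alt_sum2 B' ps = \<phi> (sum_list (map w ps)) * alt_sum2 B ps"
  using assms
proof (induction ps arbitrary: \<phi> B B')
  case (Cons a ps)
  have "alt_sum2 (\<lambda>x y r. B' x y (a # r)) ps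
      = \<phi> (w a + sum_list (map w ps)) * alt_sum2 (\<lambda>x y r. B x y (a # r)) ps"
    by (rule Cons.IH) (simp add: Cons.prems add_ac)
  moreover have "alt_sum1 (B' a) ps = \<phi> (w a + sum_list (map w ps)) * alt_sum1 (B a) ps"
    by (rule alt_sum1_sumweight) (simp add: Cons.prems add_ac)
  ultimately show ?case
    by (simp add: algebra_simps)
qed simp

text \<open>Two variables are replaced by their sum, so the total is unchanged. Taking \<phi> to be
  addition of \<open>Const a\<close> gives \<partial>; a constant \<phi> gives scalars.\<close>

lemma differential_form_weight:
  "differential_form (\<lambda>ps. \<phi> (sum_list (map snd ps)) * G ps) ps
      = \<phi> (sum_list (map snd ps)) * differential_form G ps"
  unfolding differential_form_def
  by (rule alt_sum2_sumweight) (simp add: differential_term_def sum_distrib_left mult_ac)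

lemma differential_form_add: "differential_form (\<lambda>ps. G ps + H ps) ps
    = differential_form G ps + differential_form H ps"
proof -
  have "differential_term (\<lambda>ps. G ps + H ps)
      = (\<lambda>a b r. 1 * differential_term G a b r + 1 * differential_term H a b r)"
    by (simp add: differential_term_def fun_eq_iff algebra_simps sum.distrib)
  then show ?thesis
    by (simp only: differential_form_def alt_sum2_lincomb) simp
qed


section \<open>Translation between cochains and functions of pairs\<close>

definition ev :: "cochain \<Rightarrow> (sv \<times> lpoly) list \<Rightarrow> lpoly" where
  "ev g ps = lsubst (\<lambda>m. map snd ps ! m) (g (map fst ps))"

definition with_vars :: "sv list \<Rightarrow> (sv \<times> lpoly) list" where
  "with_vars xs = zip xs (map Var [0..<length xs])"

text \<open>Inverse to \<open>ev\<close> on lists of length \<open>n\<close>, see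
  \<open>ev_with_vars\<close> and \<open>ev_cochain_of\<close>; the value 0 elsewhere is the
  normalisation of cochains.\<close>

definition cochain_of :: "nat \<Rightarrow> ((sv \<times> lpoly) list \<Rightarrow> lpoly) \<Rightarrow> cochain" where
  "cochain_of n G xs = (if length xs = n then G (with_vars xs) else 0)"

lemma length_with_vars [simp]: "length (with_vars xs) = length xs"
  by (simp add: with_vars_def)

lemma map_fst_with_vars [simp]: "map fst (with_vars xs) = xs"
  by (simp add: with_vars_def)

lemma map_snd_with_vars: "map snd (with_vars xs) = map Var [0..<length xs]"
  by (simp add: with_vars_def)

lemma nth_with_vars: "i < length xs \<Longrightarrow> with_vars xs ! i = (xs ! i, Var i)"
  by (simp add: with_vars_def)

lemma is_cochain_length: "is_cochain n g \<Longrightarrow> length xs \<noteq> n \<Longrightarrow> g xs = 0"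
  by (simp add: is_cochain_def)

lemma is_cochain_lvars: "is_cochain n g \<Longrightarrow> lvars (g xs) \<subseteq> {..<n}"
  by (cases "length xs = n") (auto simp: is_cochain_def)

lemma is_cochain_linear:
  assumes "is_cochain n g" "length xs = n" "i < n"
  shows "g (xs[i := x + y]) = g (xs[i := x]) + g (xs[i := y])"
    and "g (xs[i := sv_scale c x]) = Const c * g (xs[i := x])"
    and "g (xs[i := sv_del x]) = - Var i * g (xs[i := x])"
  using assms unfolding is_cochain_def by blast+

lemma is_cochain_skew:
  "is_cochain n g \<Longrightarrow> length xs = n \<Longrightarrow> p permutes {..<n} \<Longrightarrow>
    lsubst (\<lambda>k. Var (p k)) (g (map (\<lambda>i. xs ! p i) [0..<n])) = of_int (sign p) * g xs"
  unfolding is_cochain_def by blast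

lemma ev_length: "is_cochain n g \<Longrightarrow> length ps \<noteq> n \<Longrightarrow> ev g ps = 0"
  by (simp add: ev_def is_cochain_length)

lemma ev_with_vars: "is_cochain n g \<Longrightarrow> ev g (with_vars xs) = g xs"
proof (cases "length xs = n")
  case True
  assume g: "is_cochain n g"
  have "ev g (with_vars xs) = lsubst Var (g xs)"
    unfolding ev_def map_fst_with_vars map_snd_with_vars
    using is_cochain_lvars[OF g, of xs] True by (intro lsubst_cong) auto
  then show ?thesis
    by simp
qed (simp add: ev_length is_cochain_length)

text \<open>Any list of pairs arises by substitution from the one with the same arguments and the
  variables \<open>Var 0, Var 1, ...\<close>, so compatibility with substitutions determines
  \<open>G\<close>.\<close>

lemma ev_cochain_of:
  assumes "polyform G" "length ps = n"
  shows "ev (cochain_of n G) ps = G ps"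
proof -
  have "map (apsnd (lsubst (\<lambda>m. map snd ps ! m))) (with_vars (map fst ps)) = ps"
    by (rule nth_equalityI) (auto simp: nth_with_vars prod_eq_iff)
  then show ?thesis
    using assms by (simp add: ev_def cochain_of_def polyform_nat)
qed

text \<open>Horner's scheme extends the cochain conditions on sums, scalars and \<partial> to
  arbitrary polynomials in \<partial>.\<close>

lemma evp_smult_induct:
  assumes add: "\<And>x y. P (x + y) = P x + P y"
    and scale: "\<And>c x. P (sv_scale c x) = Const c * P x"
    and del: "\<And>x. P (sv_del x) = - p * P x"
  shows "P (f *s x) = evp f (- p) * P x"
proof (induction f arbitrary: x)
  case 0
  have "P 0 = 0"
    using add[of 0 0] by simp
  then show ?case
    by simp
next
  case (pCons c f)
  have "pCons c f *s x = sv_scale c x + sv_del (f *s x)"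
    by (simp add: sv_scale_def sv_del_def vec_eq_iff)
  then have "P (pCons c f *s x) = Const c * P x - p * P (f *s x)"
    by (simp only: add scale del) simp
  then show ?case
    by (simp add: pCons.IH algebra_simps)
qed

lemma permute_list_adjacent:
  "permute_list (transpose (length u) (Suc (length u))) (u @ a # b # v) = u @ b # a # v"
  by (simp add: permute_list_transpose nth_append list_update_append)

lemma polyform_ev:
  assumes g: "is_cochain n g"
  shows "polyform (ev g)"
proof (rule polyformI)
  show "alternating (ev g)"
    unfolding alternating_def
  proof (intro allI)
    fix u v :: "(sv \<times> lpoly) list" and a b
    let ?ps = "u @ a # b # v" and ?qs = "u @ b # a # v" and ?k = "length u"
    let ?t = "transpose ?k (Suc ?k)"
    show "ev g ?ps = - ev g ?qs"
    proof (cases "length ?ps = n")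
      case True
      have t: "?t permutes {..<n}"
        using True by (intro permutes_swap_id) auto
      have "lsubst (\<lambda>k. Var (?t k)) (g (map (\<lambda>i. map fst ?ps ! ?t i) [0..<n]))
          = of_int (sign ?t) * g (map fst ?ps)"
        using True by (intro is_cochain_skew g t) simp
      moreover have "map (\<lambda>i. map fst ?ps ! ?t i) [0..<n] = permute_list ?t (map fst ?ps)"
        using True by (simp add: permute_list_def)
      moreover have "permute_list ?t (map fst ?ps) = map fst ?qs"
        using permute_list_adjacent[of "map fst u" "fst a" "fst b" "map fst v"] by simp
      ultimately have "g (map fst ?ps) = - lsubst (\<lambda>k. Var (?t k)) (g (map fst ?qs))"
        by (simp add: sign_swap_id)
      \<comment> \<open>The swap of variables is undone by the swap in the second components. Only
        \<open>i < n\<close> matters, by the bound on \<open>lvars\<close>.\<close>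
      moreover have "map snd ?ps ! ?t i = map snd ?qs ! i" if "i < n" for i
      proof -
        have "permute_list ?t (map snd ?ps) = map snd ?qs"
          using permute_list_adjacent[of "map snd u" "snd a" "snd b" "map snd v"] by simp
        moreover have "permute_list ?t (map snd ?ps) ! i = map snd ?ps ! ?t i"
          using that t True by (intro permute_list_nth) auto
        ultimately show ?thesis
          by simp
      qed
      ultimately show ?thesis
        using is_cochain_lvars[OF g, of "map fst ?qs"]
        by (auto simp: ev_def lsubst_lsubst intro!: lsubst_cong)
    qed (simp add: ev_length[OF g])
  qed
  show "ev g (u @ (f *s x + h *s y, p) # v) =
      evp f (- p) * ev g (u @ (x, p) # v) + evp h (- p) * ev g (u @ (y, p) # v)" for u v f h x y p
  proof (cases "length (u @ (x, p) # v) = n")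
    case True
    define P where "P z = ev g (u @ (z, p) # v)" for z
    let ?xs = "map fst u @ x # map fst v"
    have len: "length ?xs = n" "length u < n"
      using True by auto
    have P: "P z = lsubst (\<lambda>m. (map snd u @ p # map snd v) ! m) (g (?xs[length u := z]))" for z
      by (simp add: P_def ev_def list_update_append)
    have add: "P (z + w) = P z + P w" for z w
      unfolding P by (simp add: is_cochain_linear(1)[OF g len])
    have scale: "P (sv_scale c z) = Const c * P z" for c z
      unfolding P by (simp add: is_cochain_linear(2)[OF g len])
    have del: "P (sv_del z) = - p * P z" for z
      unfolding P by (simp add: is_cochain_linear(3)[OF g len] nth_append)
    have "P (f *s x + h *s y) = evp f (- p) * P x + evp h (- p) * P y"
      by (simp add: add evp_smult_induct[of P p, OF add scale del])
    then show ?thesis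
      by (simp add: P_def)
  qed (simp add: ev_length[OF g])
  show "lsubst s (ev g ps) = ev g (map (apsnd (lsubst s)) ps)" for s ps
  proof (cases "length ps = n")
    case True
    then show ?thesis
      using is_cochain_lvars[OF g, of "map fst ps"]
      by (auto simp: ev_def lsubst_lsubst o_def intro!: lsubst_cong)
  qed (simp add: ev_length[OF g])
qed

lemma is_cochain_cochain_of:
  assumes G: "polyform G"
  shows "is_cochain n (cochain_of n G)"
  unfolding is_cochain_def
proof (intro conjI allI impI)
  fix xs :: "sv list"
  assume len: "length xs = n"
  \<comment> \<open>Sending the variables from index \<open>n\<close> on to 0 changes nothing, so
    \<open>lvars_lsubst\<close> bounds the variables.\<close>
  have "map (apsnd (lsubst (\<lambda>i. if i < n then Var i else 0))) (with_vars xs) = with_vars xs"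
    using len by (intro nth_equalityI) (auto simp: nth_with_vars)
  then have eq: "lsubst (\<lambda>i. if i < n then Var i else 0) (cochain_of n G xs) = cochain_of n G xs"
    using len by (simp add: cochain_of_def polyform_nat[OF G])
  have "lvars (lsubst (\<lambda>i. if i < n then Var i else 0) (cochain_of n G xs)) \<subseteq> {..<n}"
    by (rule lvars_lsubst) auto
  then show "lvars (cochain_of n G xs) \<subseteq> {..<n}"
    unfolding eq .
next
  fix xs :: "sv list" and i
  assume len: "length xs = n" and i: "i < n"
  define u v where "u = take i (with_vars xs)" and "v = drop (Suc i) (with_vars xs)"
  have cochain_of: "cochain_of n G (xs[i := x]) = G (u @ (x, Var i) # v)" for x
  proof -
    have "with_vars (xs[i := x]) = (with_vars xs)[i := (x, Var i)]"
      using len i by (intro nth_equalityI) (auto simp: nth_with_vars nth_list_update)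
    then show ?thesis
      using len i by (simp add: cochain_of_def u_def v_def upd_conv_take_nth_drop)
  qed
  show "cochain_of n G (xs[i := x + y])
      = cochain_of n G (xs[i := x]) + cochain_of n G (xs[i := y])" for x y
    using polyform_lin[OF G, of u 1 x 1 y] by (simp add: cochain_of)
  show "cochain_of n G (xs[i := sv_scale c x]) = Const c * cochain_of n G (xs[i := x])" for c x
    using polyform_lin[OF G, of u "[:c:]" x 0 0] by (simp add: cochain_of sv_scale_def)
  show "cochain_of n G (xs[i := sv_del x]) = - Var i * cochain_of n G (xs[i := x])" for x
    using polyform_lin[OF G, of u "[:0, 1:]" x 0 0] by (simp add: cochain_of sv_del_def)
next
  fix xs :: "sv list" and p
  assume len: "length xs = n" and p: "p permutes {..<n}"
  have less: "p i < n \<longleftrightarrow> i < n" for i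
    using permutes_in_image[OF p, of i] by simp
  have "map (apsnd (lsubst (\<lambda>k. Var (p k)))) (with_vars (map (\<lambda>i. xs ! p i) [0..<n]))
      = permute_list p (with_vars xs)"
    using len p by (intro nth_equalityI) (auto simp: nth_with_vars permute_list_nth less)
  then have "lsubst (\<lambda>k. Var (p k)) (cochain_of n G (map (\<lambda>i. xs ! p i) [0..<n]))
      = G (permute_list p (with_vars xs))"
    by (simp add: cochain_of_def polyform_nat[OF G])
  also have "\<dots> = of_int (sign p) * cochain_of n G xs"
    using alternating_permute_list[OF polyform_alt[OF G], of p "with_vars xs"] len p
        by (simp add: cochain_of_def)
  finally show "lsubst (\<lambda>k. Var (p k)) (cochain_of n G (map (\<lambda>i. xs ! p i) [0..<n]))
      = of_int (sign p) * cochain_of n G xs" .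
qed (simp add: cochain_of_def)

text \<open>The left side sums over powers of \<lambda> and then over generators, the right side in
  the opposite order.\<close>

lemma ext_eval_conv:
  assumes g: "is_cochain n g"
  shows "ext_eval g (u # map snd r) t B (map fst r)
      = (\<Sum>W\<in>UNIV. evpp (B $ W) t u * ev g ((axis W 1, u) # r))"
proof -
  define A where "A = {k. lam_coeff B k \<noteq> 0}"
  have "A \<subseteq> (\<Union>W\<in>UNIV. {..degree (B $ W)})"
    by (auto simp: A_def lam_coeff_def vec_eq_iff intro: le_degree)
  then have fin: "finite A"
    by (rule finite_subset) simp
  have evpp: "evpp (B $ W) t u = (\<Sum>k\<in>A. t ^ k * evp (coeff (B $ W) k) (- u))" for W
  proof -
    define q where "q = map_poly (\<lambda>f. evp f (- u)) (B $ W)"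
    have q: "coeff q k = evp (coeff (B $ W) k) (- u)" for k
      by (simp add: q_def coeff_map_poly)
    have "evpp (B $ W) t u = (\<Sum>k\<le>degree q. t ^ k * coeff q k)"
      by (simp add: evpp_def poly_altdef mult.commute flip: q_def)
    \<comment> \<open>The two index sets are compared through their union, as outside either one the
      coefficients of \<open>q\<close> vanish.\<close>
    also have "\<dots> = (\<Sum>k\<in>A \<union> {..degree q}. t ^ k * coeff q k)"
      using fin by (intro sum.mono_neutral_left) (auto intro: coeff_eq_0)
    also have "\<dots> = (\<Sum>k\<in>A. t ^ k * coeff q k)"
      using fin by (intro sum.mono_neutral_right) (auto simp: A_def lam_coeff_def vec_eq_iff q)
    finally show ?thesis
      by (simp add: q)
  qed
  have "ext_eval g (u # map snd r) t B (map fst r) = (\<Sum>k\<in>A. t ^ k * ev g ((lam_coeff B k, u) # r))"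
    by (simp add: ext_eval_def A_def ev_def)
  also have "\<dots> = (\<Sum>k\<in>A. \<Sum>W\<in>UNIV. t ^ k * evp (coeff (B $ W) k) (- u) * ev g ((axis W 1, u) # r))"
  proof (rule sum.cong[OF refl])
    fix k
    have "ev g ((lam_coeff B k, u) # r)
        = (\<Sum>W\<in>UNIV. evp (lam_coeff B k $ W) (- u) * ev g ((axis W 1, u) # r))"
      using polyform_expand[OF polyform_ev[OF g], of "[]" "lam_coeff B k" u r] by simp
    also have "\<dots> = (\<Sum>W\<in>UNIV. evp (coeff (B $ W) k) (- u) * ev g ((axis W 1, u) # r))"
      by (simp add: lam_coeff_def)
    finally show "t ^ k * ev g ((lam_coeff B k, u) # r)
        = (\<Sum>W\<in>UNIV. t ^ k * evp (coeff (B $ W) k) (- u) * ev g ((axis W 1, u) # r))"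
      by (simp add: sum_distrib_left mult_ac)
  qed
  also have "\<dots> = (\<Sum>W\<in>UNIV. evpp (B $ W) t u * ev g ((axis W 1, u) # r))"
    by (subst sum.swap) (simp add: evpp sum_distrib_right)
  finally show ?thesis .
qed

text \<open>From here on the differential is handled only through
  \<open>differential_form\<close>.\<close>

lemma cochain_d_conv:
  assumes g: "is_cochain n g"
  shows "cochain_d n g = cochain_of (Suc n) (differential_form (ev g))"
proof
  fix xs :: "sv list"
  show "cochain_d n g xs = cochain_of (Suc n) (differential_form (ev g)) xs"
  proof (cases "length xs = Suc n")
    case True
    define zs where "zs = with_vars xs"
    have "ext_eval g ((Var i + Var j) # omit2 i j (map Var [0..<n + 1])) (Var i)
        (sv_bracket (xs ! i) (xs ! j)) (omit2 i j xs)
            = differential_term (ev g) (zs ! i) (zs ! j) (omit2 i j zs)"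
      if "i < j" "j < n + 1" for i j
    proof -
      have fst: "omit2 i j xs = map fst (omit2 i j zs)"
        by (simp add: omit2_def zs_def flip: nths_map)
      have snd: "omit2 i j (map Var [0..<n + 1]) = map snd (omit2 i j zs)"
        using True by (simp add: omit2_def zs_def map_snd_with_vars flip: nths_map)
      show ?thesis
        unfolding fst snd ext_eval_conv[OF g] evpp_sv_bracket
        using that True by (simp add: differential_term_def zs_def nth_with_vars)
    qed
    then have "cochain_d n g xs
        = (\<Sum>j<n + 1. \<Sum>i<j. (- 1) ^ (i + j) * differential_term (ev g) (zs ! i) (zs ! j) (omit2 i j zs))"
      using True by (simp add: cochain_d_def del: sum.lessThan_Suc)
    also have "\<dots> = differential_form (ev g) zs"
      using True by (simp add: differential_form_def alt_sum2_conv zs_def del: sum.lessThan_Suc)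
    finally show ?thesis
      using True by (simp add: cochain_of_def zs_def)
  qed (simp add: cochain_d_def cochain_of_def)
qed

lemma cochain_del_conv:
  assumes g: "is_cochain n g"
  shows "cochain_del a n g = cochain_of n (\<lambda>ps. (Const a + sum_list (map snd ps)) * ev g ps)"
proof
  fix xs :: "sv list"
  have "sum_list (map snd (with_vars xs)) = (\<Sum>i<length xs. Var i)"
    by (simp add: map_snd_with_vars interv_sum_list_conv_sum_set_nat atLeast0LessThan)
  then show "cochain_del a n g xs = cochain_of n (\<lambda>ps. (Const a + sum_list (map snd ps)) * ev g ps) xs"
    by (simp add: cochain_del_def cochain_of_def ev_with_vars[OF g] is_cochain_length[OF g])
qed

section \<open>Closure properties of cochains, and commutation of the differential with
  \<partial>\<close>

lemma is_cochain_d: "is_cochain n g \<Longrightarrow> is_cochain (Suc n) (cochain_d n g)"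
  by (simp add: cochain_d_conv is_cochain_cochain_of polyform_differential_form polyform_ev)

lemma is_cochain_del: "is_cochain n g \<Longrightarrow> is_cochain n (cochain_del a n g)"
  using polyform_mult[OF polyform_ev, of n g a 1]
  by (simp add: cochain_del_conv is_cochain_cochain_of)

lemma is_cochain_add:
  assumes "is_cochain n g" "is_cochain n h"
  shows "is_cochain n (\<lambda>xs. g xs + h xs)"
proof -
  have "(\<lambda>xs. g xs + h xs) = cochain_of n (\<lambda>ps. ev g ps + ev h ps)"
    by (auto simp: cochain_of_def fun_eq_iff ev_with_vars[OF assms(1)] ev_with_vars[OF assms(2)]
        is_cochain_length[OF assms(1)] is_cochain_length[OF assms(2)])
  then show ?thesis
    using is_cochain_cochain_of[OF polyform_add[OF polyform_ev[OF assms(1)] polyform_ev[OF assms(2)]], of n] by simp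
qed

lemma is_cochain_scale:
  assumes "is_cochain n g"
  shows "is_cochain n (\<lambda>xs. Const c * g xs)"
proof -
  have "(\<lambda>xs. Const c * g xs)
      = cochain_of n (\<lambda>ps. (Const c + Const 0 * sum_list (map snd ps)) * ev g ps)"
    by (auto simp: cochain_of_def fun_eq_iff ev_with_vars[OF assms] is_cochain_length[OF assms])
  then show ?thesis
    using is_cochain_cochain_of[OF polyform_mult[OF polyform_ev[OF assms], of c 0], of n] by simp
qed

lemma is_cochain_uminus: "is_cochain n g \<Longrightarrow> is_cochain n (\<lambda>xs. - g xs)"
  using is_cochain_scale[of n g "- 1"] by simp

lemma is_cochain_0: "is_cochain n (\<lambda>_. 0)"
  by (simp add: is_cochain_def)

lemma ev_add: "ev (\<lambda>xs. g xs + h xs) = (\<lambda>ps. ev g ps + ev h ps)"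
  by (simp add: ev_def fun_eq_iff)

lemma cochain_d_add:
  assumes "is_cochain n g" "is_cochain n h"
  shows "cochain_d n (\<lambda>xs. g xs + h xs) = (\<lambda>xs. cochain_d n g xs + cochain_d n h xs)"
  by (simp add: cochain_d_conv assms is_cochain_add ev_add cochain_of_def differential_form_add fun_eq_iff)

lemma ev_cochain_del:
  assumes "is_cochain n g"
  shows "ev (cochain_del a n g) ps = (Const a + sum_list (map snd ps)) * ev g ps"
proof (cases "length ps = n")
  case True
  with polyform_mult[OF polyform_ev, of n g a 1] show ?thesis
    by (simp add: cochain_del_conv assms ev_cochain_of)
qed (simp add: ev_length[OF assms] ev_length[OF is_cochain_del[OF assms]])

lemma cochain_d_del:
  assumes "is_cochain n g"
  shows "cochain_d n (cochain_del a n g) = cochain_del a (Suc n) (cochain_d n g)"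
proof -
  have *: "ev (cochain_del a n g) = (\<lambda>ps. (Const a + sum_list (map snd ps)) * ev g ps)"
    by (simp add: ev_cochain_del[OF assms] fun_eq_iff)
  have "cochain_d n (cochain_del a n g)
      = cochain_of (Suc n) (\<lambda>ps. (Const a + sum_list (map snd ps)) * differential_form (ev g) ps)"
    using differential_form_weight[of "\<lambda>t. Const a + t" "ev g"]
    unfolding cochain_d_conv[OF is_cochain_del[OF assms]] * by presburger
  also have "\<dots> = cochain_del a (Suc n) (cochain_d n g)"
    using is_cochain_d[OF assms]
    by (auto simp: cochain_del_conv cochain_of_def fun_eq_iff ev_with_vars) (simp add: cochain_d_conv assms cochain_of_def)
  finally show ?thesis .
qed

lemma cochain_del_add: "cochain_del a n (\<lambda>xs. g xs + h xs)
    = (\<lambda>xs. cochain_del a n g xs + cochain_del a n h xs)"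
  by (simp add: cochain_del_def fun_eq_iff algebra_simps)

section \<open>Contraction of cochains and exactness of reduced cocycles\<close>

lemma is_cochain_contract:
  assumes "is_cochain (Suc n) g"
  shows "is_cochain n (cochain_of n (\<lambda>r. ev g ((x, 0) # r)))"
  by (intro is_cochain_cochain_of polyform_Cons_0 polyform_ev[OF assms])

text \<open>Both sides vanish on lists of the wrong length; being an equality of functions, it can
  be used inside \<open>differential_form\<close>.\<close>

lemma ev_contract:
  assumes "is_cochain (Suc n) g"
  shows "ev (cochain_of n (\<lambda>r. ev g ((x, 0) # r))) = (\<lambda>r. ev g ((x, 0) # r))"
proof
  fix r
  show "ev (cochain_of n (\<lambda>r. ev g ((x, 0) # r))) r = ev g ((x, 0) # r)"
  proof (cases "length r = n")
    case True
    then show ?thesis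
      by (rule ev_cochain_of[OF polyform_Cons_0[OF polyform_ev[OF assms]]])
  qed (simp add: ev_length[OF is_cochain_contract[OF assms]] ev_length[OF assms])
qed

text \<open>In degree 0 there are no variables, and \<partial> is multiplication by the invertible
  scalar \<open>a\<close>.\<close>

lemma reduced_cocycle_exact_0:
  assumes "a \<noteq> 0" "is_cochain 0 g"
  obtains \<psi> where "is_cochain 0 \<psi>" "g = cochain_del a 0 \<psi>"
proof
  show "is_cochain 0 (\<lambda>xs. Const (1 / a) * g xs)"
    by (rule is_cochain_scale[OF assms(2)])
  have "Const a * Const (1 / a) = 1"
    using assms(1) by (simp flip: Const_simps(4))
  then show "g = cochain_del a 0 (\<lambda>xs. Const (1 / a) * g xs)"
    by (simp add: cochain_del_def fun_eq_iff flip: mult.assoc)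
qed

lemma reduced_cocycle_exact:
  assumes "a \<noteq> 0" and g: "is_cochain (Suc m) g" and \<phi>: "is_cochain (Suc (Suc m)) \<phi>"
    and eq: "cochain_d (Suc m) g = cochain_del a (Suc (Suc m)) \<phi>"
  obtains \<psi> \<eta> where "is_cochain (Suc m) \<psi>" "is_cochain m \<eta>"
    "g = (\<lambda>xs. cochain_del a (Suc m) \<psi> xs + cochain_d m \<eta> xs)"
proof -
  let ?e = "(axis GenL 1, 0) :: sv \<times> lpoly"
  define hg where "hg = cochain_of m (\<lambda>r. ev g (?e # r))"
  define h\<phi> where "h\<phi> = cochain_of (Suc m) (\<lambda>r. ev \<phi> (?e # r))"
  \<comment> \<open>The witnesses come from dividing a g = \<partial>(g - h\<phi>) - d(hg) by
    \<open>a\<close>.\<close>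
  define \<psi> where "\<psi> = (\<lambda>xs. Const (1 / a) * (g xs + - h\<phi> xs))"
  define \<eta> where "\<eta> = (\<lambda>xs. Const (- 1 / a) * hg xs)"
  have hg: "is_cochain m hg" and h\<phi>: "is_cochain (Suc m) h\<phi>"
    unfolding hg_def h\<phi>_def by (intro is_cochain_contract g \<phi>)+
  have \<psi>: "is_cochain (Suc m) \<psi>" and \<eta>: "is_cochain m \<eta>"
    unfolding \<psi>_def \<eta>_def by (intro is_cochain_scale is_cochain_add is_cochain_uminus g hg h\<phi>)+
  have inv: "Const a * Const (1 / a) = 1"
    using assms(1) by (simp flip: Const_simps(4))
  have "g xs = cochain_del a (Suc m) \<psi> xs + cochain_d m \<eta> xs" for xs
  proof (cases "length xs = Suc m")
    case True
    define zs where "zs = with_vars xs"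
    define S where "S = sum_list (map snd zs)"
    have [simp]: "ev g zs = g xs" "ev h\<phi> zs = h\<phi> xs" "ev \<psi> zs = \<psi> xs"
      by (simp_all add: zs_def ev_with_vars[OF g] ev_with_vars[OF h\<phi>] ev_with_vars[OF \<psi>])
    have "differential_form (ev g) (?e # zs) = ev (cochain_d (Suc m) g) (?e # zs)"
      using True by (simp add: cochain_d_conv[OF g] zs_def ev_cochain_of polyform_differential_form polyform_ev[OF g])
    \<comment> \<open>The pair \<open>?e\<close> has variable 0 and adds nothing to the sum, so
      \<partial> on \<phi> still multiplies by \<open>Const a + S\<close>.\<close>
    also have "\<dots> = (Const a + S) * h\<phi> xs"
      using ev_contract[OF \<phi>, of "axis GenL 1", folded h\<phi>_def]
      by (simp add: eq ev_cochain_del[OF \<phi>] S_def fun_eq_iff flip: \<open>ev h\<phi> zs = h\<phi> xs\<close>)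
    finally have 1: "(Const a + S) * h\<phi> xs + differential_form (ev hg) zs = S * g xs"
      using cartan[OF polyform_ev[OF g], of zs] ev_contract[OF g, of "axis GenL 1", folded hg_def]
      by (simp add: S_def)
    have "ev \<eta> = (\<lambda>ps. Const (- 1 / a) * ev hg ps)"
      by (simp add: \<eta>_def ev_def fun_eq_iff)
    then have "differential_form (ev \<eta>) zs = Const (- 1 / a) * differential_form (ev hg) zs"
      using differential_form_weight[of "\<lambda>_. Const (- 1 / a)" "ev hg" zs] by simp
    then have 2: "cochain_d m \<eta> xs = - Const (1 / a) * differential_form (ev hg) zs"
      using True by (simp add: cochain_d_conv[OF \<eta>] cochain_of_def zs_def)
    have 3: "cochain_del a (Suc m) \<psi> xs = (Const a + S) * \<psi> xs"
      using True by (simp add: cochain_del_conv[OF \<psi>] cochain_of_def S_def flip: zs_def)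
    have "(Const a + S) * \<psi> xs + - Const (1 / a) * differential_form (ev hg) zs
        = Const (1 / a) * ((Const a
            + S) * g xs - ((Const a + S) * h\<phi> xs + differential_form (ev hg) zs))"
      by (simp add: \<psi>_def algebra_simps)
    \<comment> \<open>By Cartan's formula the bracket is (a + S) g - S g = a g.\<close>
    also have "\<dots> = Const a * Const (1 / a) * g xs"
      unfolding 1 by (simp add: algebra_simps)
    finally show ?thesis
      unfolding 2 3 inv by simp
  qed (use is_cochain_length[OF g] is_cochain_length[OF is_cochain_del[OF \<psi>]] is_cochain_length[OF is_cochain_d[OF \<eta>]] in simp)
  then show thesis
    using that \<psi> \<eta> by blast
qed


section \<open>Triviality of the reduced cohomology\<close>

lemma cochain_group_simps [simp]:
  "g \<in> carrier (cochain_group n) \<longleftrightarrow> is_cochain n g"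
  "mult (cochain_group n) g h = (\<lambda>xs. g xs + h xs)"
  "one (cochain_group n) = (\<lambda>_. 0)"
  by (simp_all add: cochain_group_def)

lemma comm_group_cochain_group: "comm_group (cochain_group n)"
proof (rule comm_groupI)
  show "\<exists>h\<in>carrier (cochain_group n). h \<otimes>\<^bsub>cochain_group n\<^esub> g = \<one>\<^bsub>cochain_group n\<^esub>"
    if "g \<in> carrier (cochain_group n)" for g
    using that by (intro bexI[of _ "\<lambda>xs. - g xs"]) (simp_all add: is_cochain_uminus)
qed (simp_all add: is_cochain_add is_cochain_0 add_ac)

lemma group_cochain_group: "group (cochain_group n)"
  using comm_group_cochain_group by (rule comm_group.axioms(2))

lemma normal_del_cochains: "del_cochains a n \<lhd> cochain_group n"
proof -
  have "cochain_del a n \<in> hom (cochain_group n) (cochain_group n)"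
    by (rule homI) (simp_all add: is_cochain_del cochain_del_add)
  then have "group_hom (cochain_group n) (cochain_group n) (cochain_del a n)"
    by (simp add: group_hom_def group_hom_axioms_def group_cochain_group)
  then have "subgroup (del_cochains a n) (cochain_group n)"
    unfolding del_cochains_def by (rule group_hom.img_is_subgroup)
  then show ?thesis
    using comm_group_cochain_group by (simp add: comm_group.subgroup_imp_normal)
qed

lemma subgroup_del_cochains: "subgroup (del_cochains a n) (cochain_group n)"
  using normal_del_cochains by (rule normal_imp_subgroup)

section \<open>The reduced complex as quotient groups with the induced differential\<close>

lemma group_reduced_group: "group (reduced_group a n)"
  unfolding reduced_group_def by (rule normal.factorgroup_is_group[OF normal_del_cochains])

lemma carrier_reduced_group:
  "carrier (reduced_group a n) = {del_cochains a n #>\<^bsub>cochain_group n\<^esub> g | g. is_cochain n g}"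
  by (auto simp: reduced_group_def FactGroup_def RCOSETS_def)

lemma one_reduced_group: "\<one>\<^bsub>reduced_group a n\<^esub> = del_cochains a n"
  by (simp add: reduced_group_def FactGroup_def)

lemma mult_reduced_group:
  assumes "is_cochain n g" "is_cochain n h"
  shows "(del_cochains a n #>\<^bsub>cochain_group n\<^esub> g) \<otimes>\<^bsub>reduced_group a n\<^esub> (del_cochains a n #>\<^bsub>cochain_group n\<^esub> h)
    = del_cochains a n #>\<^bsub>cochain_group n\<^esub> (\<lambda>xs. g xs + h xs)"
  using normal.rcos_sum[OF normal_del_cochains, of g n h a] assms
  by (simp add: reduced_group_def FactGroup_def)

lemma del_coset_add:
  assumes "is_cochain n g" "is_cochain n \<psi>"
  shows "del_cochains a n #>\<^bsub>cochain_group n\<^esub> (\<lambda>xs. cochain_del a n \<psi> xs + g xs)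
    = del_cochains a n #>\<^bsub>cochain_group n\<^esub> g"
proof -
  have "cochain_del a n \<psi> \<in> del_cochains a n"
    using assms by (simp add: del_cochains_def)
  then have "del_cochains a n #>\<^bsub>cochain_group n\<^esub> cochain_del a n \<psi> = del_cochains a n"
    using assms
    by (intro group.coset_join2 group_cochain_group subgroup_del_cochains) (simp_all add: is_cochain_del)
  then show ?thesis
    using group.coset_mult_assoc[OF group_cochain_group subgroup.subset[OF subgroup_del_cochains],
        of "cochain_del a n \<psi>" n g a] assms
    by (simp add: is_cochain_del)
qed

text \<open>Members of one coset differ by some \<partial>\<psi>, whose differential is
  \<partial>(d\<psi>). Hence all cosets in the union defining \<open>reduced_d\<close>
  agree.\<close>

lemma reduced_d_coset:
  assumes g: "is_cochain m g"
  shows "reduced_d a m (del_cochains a m #>\<^bsub>cochain_group m\<^esub> g)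
    = del_cochains a (Suc m) #>\<^bsub>cochain_group (Suc m)\<^esub> cochain_d m g"
proof -
  have "del_cochains a (Suc m) #>\<^bsub>cochain_group (Suc m)\<^esub> cochain_d m x
      = del_cochains a (Suc m) #>\<^bsub>cochain_group (Suc m)\<^esub> cochain_d m g"
    if "x \<in> del_cochains a m #>\<^bsub>cochain_group m\<^esub> g" for x
  proof -
    obtain \<psi> where \<psi>: "is_cochain m \<psi>" "x = (\<lambda>xs. cochain_del a m \<psi> xs + g xs)"
      using \<open>x \<in> _\<close> by (auto simp: r_coset_def del_cochains_def)
    have "cochain_d m x = (\<lambda>xs. cochain_del a (Suc m) (cochain_d m \<psi>) xs + cochain_d m g xs)"
      using g \<psi> by (simp add: cochain_d_add is_cochain_del cochain_d_del)
    then show ?thesis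
      using g \<psi> by (simp add: del_coset_add is_cochain_d)
  qed
  moreover have "g \<in> del_cochains a m #>\<^bsub>cochain_group m\<^esub> g"
    using g by (intro group.rcos_self group_cochain_group subgroup_del_cochains) simp
  ultimately show ?thesis
    unfolding reduced_d_def by blast
qed

lemma group_hom_reduced_d:
  "group_hom (reduced_group a m) (reduced_group a (Suc m)) (reduced_d a m)"
proof -
  have "reduced_d a m \<in> hom (reduced_group a m) (reduced_group a (Suc m))"
  proof (rule homI)
    fix X assume "X \<in> carrier (reduced_group a m)"
    then show "reduced_d a m X \<in> carrier (reduced_group a (Suc m))"
      by (auto simp: carrier_reduced_group reduced_d_coset intro: is_cochain_d)
  next
    fix X Y assume "X \<in> carrier (reduced_group a m)" "Y \<in> carrier (reduced_group a m)"
    then show "reduced_d a m (X \<otimes>\<^bsub>reduced_group a m\<^esub> Y)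
        = reduced_d a m X \<otimes>\<^bsub>reduced_group a (Suc m)\<^esub> reduced_d a m Y"
      by (auto simp: carrier_reduced_group reduced_d_coset mult_reduced_group is_cochain_d
          is_cochain_add cochain_d_add)
  qed
  then show ?thesis
    by (simp add: group_hom_def group_hom_axioms_def group_reduced_group)
qed

lemma subgroup_reduced_coboundaries: "subgroup (reduced_coboundaries a q) (reduced_group a q)"
proof (cases q)
  case 0
  then show ?thesis
    by (simp add: reduced_coboundaries_def group.triv_subgroup group_reduced_group)
next
  case (Suc m)
  then show ?thesis
    using group_hom.img_is_subgroup[OF group_hom_reduced_d] by (simp add: reduced_coboundaries_def)
qed

lemma one_in_reduced_cocycles: "\<one>\<^bsub>reduced_group a q\<^esub> \<in> reduced_cocycles a q"
  unfolding reduced_cocycles_def kernel_def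
  using group_hom.hom_one[OF group_hom_reduced_d, of a q] group.is_monoid[OF group_reduced_group]
  by (simp add: monoid.one_closed)

lemma reduced_cocycles_subset_coboundaries:
  assumes "a \<noteq> 0"
  shows "reduced_cocycles a q \<subseteq> reduced_coboundaries a q"
proof
  fix X assume "X \<in> reduced_cocycles a q"
  then obtain g where g: "is_cochain q g" and X: "X = del_cochains a q #>\<^bsub>cochain_group q\<^esub> g"
    and dX: "reduced_d a q X = del_cochains a (Suc q)"
    by (auto simp: reduced_cocycles_def kernel_def carrier_reduced_group one_reduced_group)
  show "X \<in> reduced_coboundaries a q"
  proof (cases q)
    case 0
    obtain \<psi> where "is_cochain 0 \<psi>" "g = cochain_del a 0 \<psi>"
      using reduced_cocycle_exact_0[OF assms] g 0 by blast
    then have "X = del_cochains a 0 #>\<^bsub>cochain_group 0\<^esub> (\<lambda>xs. 0)"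
      using del_coset_add[OF is_cochain_0, of 0 \<psi> a] X 0 by simp
    then show ?thesis
      using group.coset_mult_one[OF group_cochain_group subgroup.subset[OF subgroup_del_cochains], of 0 a] 0
      by (simp add: reduced_coboundaries_def one_reduced_group)
  next
    case (Suc m)
    \<comment> \<open>A representative lies in its own coset, so vanishing of the reduced
      differential means dg = \<partial>\<phi>.\<close>
    have "cochain_d q g \<in> del_cochains a (Suc q) #>\<^bsub>cochain_group (Suc q)\<^esub> cochain_d q g"
      using g by (intro group.rcos_self group_cochain_group subgroup_del_cochains) (simp add: is_cochain_d)
    then have "cochain_d q g \<in> del_cochains a (Suc q)"
      using dX reduced_d_coset[OF g] X by simp
    then obtain \<phi> where \<phi>: "is_cochain (Suc q) \<phi>" "cochain_d q g = cochain_del a (Suc q) \<phi>"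
      by (auto simp: del_cochains_def)
    obtain \<psi> \<eta> where \<psi>: "is_cochain q \<psi>" and \<eta>: "is_cochain m \<eta>"
      and "g = (\<lambda>xs. cochain_del a q \<psi> xs + cochain_d m \<eta> xs)"
      using reduced_cocycle_exact[OF assms, of m g \<phi>] g \<phi> Suc by blast
    \<comment> \<open>The summand \<partial>\<psi> disappears in the quotient.\<close>
    then have "X = reduced_d a m (del_cochains a m #>\<^bsub>cochain_group m\<^esub> \<eta>)"
      using X Suc by (simp add: del_coset_add is_cochain_d reduced_d_coset)
    then show ?thesis
      using \<eta> Suc by (auto simp: reduced_coboundaries_def carrier_reduced_group)
  qed
qed

text \<open>Every coset of \<open>H\<close> by an element of \<open>K\<close> is \<open>H\<close>
  itself, so the quotient has the single element \<open>H\<close>; the group axioms are then checked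
  on it directly.\<close>

lemma trivial_group_Mod:
  assumes G: "group G" and H: "subgroup H G" and "K \<subseteq> H" "K \<noteq> {}"
  shows "trivial_group (G\<lparr>carrier := K\<rparr> Mod H)"
proof -
  have "H #>\<^bsub>G\<lparr>carrier := K\<rparr>\<^esub> x = H" if "x \<in> K" for x
    using group.coset_join2[OF G _ H, of x] that assms subgroup.subset[OF H] by (auto simp: r_coset_def)
  then have carrier: "carrier (G\<lparr>carrier := K\<rparr> Mod H) = {H}"
    using \<open>K \<noteq> {}\<close> by (auto simp: FactGroup_def RCOSETS_def)
  have one: "\<one>\<^bsub>G\<lparr>carrier := K\<rparr> Mod H\<^esub> = H"
    by (simp add: FactGroup_def)
  have "group (G\<lparr>carrier := K\<rparr> Mod H)"
    by (rule groupI) (simp_all add: carrier one group.subgroup_mult_id[OF G H])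
  then show ?thesis
    by (simp add: trivial_group_def carrier one)
qed

theorem theorem4p4:
  fixes a :: complex and q :: nat
  assumes "a \<noteq> 0"
  shows "trivial_group (reduced_cohomology a q)"
  unfolding reduced_cohomology_def
  using trivial_group_Mod[OF group_reduced_group subgroup_reduced_coboundaries
      reduced_cocycles_subset_coboundaries[OF assms]] one_in_reduced_cocycles
  by blast

end
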